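(* Suppose $\nu:\mathcal{P}\to\mathcal{H}$ is pathwise differentiable at $P_0$ with efficient influence function $\phi_0\in L^2(P_0;\mathcal{H})$, that $\mathcal{R}_n^j=o_p(n^{-1/2})$ and $\mathcal{D}_n^j=o_p(n^{-1/2})$ for $j\in\{1,2\}$, that $\|\phi_0\|_{L^2(P_0;\mathcal{H})}>0$, that $\Omega_n\in\mathcal{O}$, $\Omega_0\in\mathcal{O}$, and $\|\Omega_n-\Omega_0\|_{\mathrm{op}}=o_p(1)$. Let $\alpha\in(0,1)$, let $\zeta_{1-\alpha}$ be the $(1-\alpha)$-quantile of $w(\mathbb{H};\Omega_0)$, and let $\widehat{\zeta}_n$ be measurable with respect to $Z_1,\dots,Z_n$. (i) If $\widehat{\zeta}_n\to\zeta_{1-\alpha}$ in probability, then $\lim_{n\to\infty}P_0^n\{\nu(P_0)\in\mathcal{C}_n(\widehat{\zeta}_n)\}=1-\alpha$. (ii) If $P_0^n\{\widehat{\zeta}_n\ge\zeta_{1-\alpha}-\delta\}\to1$ for all $\delta>0$, then $\liminf_{n\to\infty}P_0^n\{\nu(P_0)\in\mathcal{C}_n(\widehat{\zeta}_n)\}\ge1-\alpha$.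
   Context: Let $(\mathcal{Z},\mathbf{B})$ be a Polish space, $\mathcal{P}$ a model of distributions dominated by a $\sigma$-finite measure $\lambda$, $\mathcal{H}$ a real separable Hilbert space. $\nu$ is pathwise differentiable at $P$ if there is a continuous linear $\dot{\nu}_P$ from the tangent space $\dot{\mathcal{P}}_P$ (closed linear span in $L^2(P)$ of scores $s$ of submodels $\{P_\epsilon\}\subset\mathcal{P}$ with $\|p_\epsilon^{1/2}-p^{1/2}-\epsilon sp^{1/2}/2\|_{L^2(\lambda)}=o(\epsilon)$) to $\mathcal{H}$ with $\|\nu(P_\epsilon)-\nu(P)-\epsilon\dot{\nu}_P(s)\|_{\mathcal{H}}=o(\epsilon)$ along every such submodel; $\dot{\nu}_P^*$ is its adjoint and $\phi_P$ is the efficient influence function (EIF) if $\dot{\nu}_P^*(h)(z)=\langle h,\phi_P(z)\rangle_{\mathcal{H}}$ for all $h$ and $P$-a.e. $z$. $L^2(P;\mathcal{H})$: Bochner measurable $f$ with $\int\|f\|^2_{\mathcal{H}}dP<\infty$; $Qf=\int f\,dQ$. Cross-fitting: $P_0\in\mathcal{P}$, $n$ even, $Z_1,\dots,Z_n$ iid $P_0$; $\widehat{P}_n^1\in\mathcal{P}$ estimates $P_0$ from $Z_1,\dots,Z_{n/2}$ and $P_n^1$ is the empirical distribution of $Z_{n/2+1},\dots,Z_n$; $\widehat{P}_n^2$ uses $Z_{n/2+1},\dots,Z_n$ and $P_n^2$ is the empirical distribution of $Z_1,\dots,Z_{n/2}$; $\phi_n^j$ is the EIF of $\nu$ at $\widehat{P}_n^j$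 (assumed to exist). $\bar{\nu}_n=\frac12\sum_j[\nu(\widehat{P}_n^j)+P_n^j\phi_n^j]$, $\mathcal{R}_n^j=\nu(\widehat{P}_n^j)+P_0\phi_n^j-\nu(P_0)$, $\mathcal{D}_n^j=(P_n^j-P_0)(\phi_n^j-\phi_0)$. $\mathbb{H}$ is a tight $\mathcal{H}$-valued Gaussian random variable with $\langle\mathbb{H},h\rangle_{\mathcal{H}}\sim N(0,E_0[\langle\phi_0(Z),h\rangle_{\mathcal{H}}^2])$ for each $h$. $\mathcal{O}$ is the set of continuous, self-adjoint, positive definite linear operators $\mathcal{H}\to\mathcal{H}$; for $\Omega\in\mathcal{O}$, $w(h;\Omega)=\langle\Omega(h),h\rangle_{\mathcal{H}}$. $\Omega_n$ is an $\mathcal{O}$-valued estimator and $\Omega_0\in\mathcal{O}$ fixed. For $\zeta\ge0$, $\mathcal{C}_n(\zeta)=\{h\in\mathcal{H}:w(\bar{\nu}_n-h;\Omega_n)\le\zeta/n\}$. *)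

theory Defs
  imports "HOL-Probability.Probability"
begin

definition dominated_model :: "'z::topological_space measure \<Rightarrow> 'z measure set \<Rightarrow> bool" where
  "dominated_model lam M \<longleftrightarrow> sigma_finite_measure lam \<and> sets lam = sets borel \<and>
     (\<forall>P\<in>M. prob_space P \<and> sets P = sets borel \<and> absolutely_continuous lam P)"

definition dens :: "'z measure \<Rightarrow> 'z measure \<Rightarrow> 'z \<Rightarrow> real" where
  "dens lam P z = enn2real (RN_deriv lam P z)"

definition qmd_path ::
  "'z::topological_space measure \<Rightarrow> 'z measure set \<Rightarrow> 'z measure \<Rightarrow> (real \<Rightarrow> 'z measure) \<Rightarrow> ('z \<Rightarrow> real) \<Rightarrow> bool" where
  "qmd_path lam M P Pe s \<longleftrightarrow>
     (\<forall>\<^sub>F e in nhds 0. Pe e \<in> M) \<and> Pe 0 = P \<and>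
     s \<in> borel_measurable borel \<and> integrable P (\<lambda>z. (s z)\<^sup>2) \<and>
     (\<forall>c>0. \<forall>\<^sub>F e in at 0.
        (\<integral>\<^sup>+ z. ennreal ((sqrt (dens lam (Pe e) z) - sqrt (dens lam P z)
                             - e * s z * sqrt (dens lam P z) / 2)\<^sup>2) \<partial>lam)
        \<le> ennreal (c * e\<^sup>2))"

definition is_score :: "'z::topological_space measure \<Rightarrow> 'z measure set \<Rightarrow> 'z measure \<Rightarrow> ('z \<Rightarrow> real) \<Rightarrow> bool" where
  "is_score lam M P s \<longleftrightarrow> (\<exists>Pe. qmd_path lam M P Pe s)"

definition tangent_space :: "'z::topological_space measure \<Rightarrow> 'z measure set \<Rightarrow> 'z measure \<Rightarrow> ('z \<Rightarrow> real) set" where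
  "tangent_space lam M P =
     {f. f \<in> borel_measurable borel \<and> integrable P (\<lambda>z. (f z)\<^sup>2) \<and>
        (\<forall>c>0. \<exists>(k::nat) (a::nat \<Rightarrow> real) (s::nat \<Rightarrow> 'z \<Rightarrow> real).
            (\<forall>i<k. is_score lam M P (s i)) \<and>
            (\<integral>z. (f z - (\<Sum>i<k. a i * s i z))\<^sup>2 \<partial>P) < c)}"

definition pathwise_deriv ::
  "'z::topological_space measure \<Rightarrow> 'z measure set \<Rightarrow> ('z measure \<Rightarrow> 'h::real_normed_vector) \<Rightarrow> 'z measure
     \<Rightarrow> (('z \<Rightarrow> real) \<Rightarrow> 'h) \<Rightarrow> bool" where
  "pathwise_deriv lam M \<nu> P D \<longleftrightarrow>
     (\<forall>f\<in>tangent_space lam M P. \<forall>g\<in>tangent_space lam M P. \<forall>a b::real.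
         D (\<lambda>z. a * f z + b * g z) = a *\<^sub>R D f + b *\<^sub>R D g) \<and>
     (\<exists>C. \<forall>f\<in>tangent_space lam M P. norm (D f) \<le> C * sqrt (\<integral>z. (f z)\<^sup>2 \<partial>P)) \<and>
     (\<forall>Pe s. qmd_path lam M P Pe s \<longrightarrow>
         ((\<lambda>e. norm (\<nu> (Pe e) - \<nu> P - e *\<^sub>R D s) / \<bar>e\<bar>) \<longlongrightarrow> 0) (at 0))"

definition pathwise_differentiable ::
  "'z::topological_space measure \<Rightarrow> 'z measure set \<Rightarrow> ('z measure \<Rightarrow> 'h::real_normed_vector) \<Rightarrow> 'z measure \<Rightarrow> bool" where
  "pathwise_differentiable lam M \<nu> P \<longleftrightarrow> (\<exists>D. pathwise_deriv lam M \<nu> P D)"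

text \<open>phi is the efficient influence function of nu at P: the adjoint of the
  pathwise derivative is h |-> (z |-> <h, phi z>), i.e. this function lies in the
  tangent space and <D f, h>_H = <f, z |-> <h, phi z>>_{L2(P)} for all f in the tangent space.\<close>
definition is_EIF ::
  "'z::topological_space measure \<Rightarrow> 'z measure set \<Rightarrow> ('z measure \<Rightarrow> 'h::real_inner) \<Rightarrow> 'z measure
     \<Rightarrow> ('z \<Rightarrow> 'h) \<Rightarrow> bool" where
  "is_EIF lam M \<nu> P \<phi> \<longleftrightarrow>
     (\<exists>D. pathwise_deriv lam M \<nu> P D \<and>
        (\<forall>h. (\<lambda>z. inner h (\<phi> z)) \<in> tangent_space lam M P \<and>
             (\<forall>f\<in>tangent_space lam M P. inner (D f) h = (\<integral>z. f z * inner h (\<phi> z) \<partial>P))))"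

definition L2H :: "'z measure \<Rightarrow> ('z \<Rightarrow> 'h::real_normed_vector) set" where
  "L2H P = {f. f \<in> borel_measurable P \<and> integrable P (\<lambda>z. (norm (f z))\<^sup>2)}"

definition op_class :: "('h::real_inner \<Rightarrow>\<^sub>L 'h) set" where
  "op_class = {\<Omega>. (\<forall>x y. inner (blinfun_apply \<Omega> x) y = inner x (blinfun_apply \<Omega> y)) \<and>
                  (\<forall>h. h \<noteq> 0 \<longrightarrow> inner (blinfun_apply \<Omega> h) h > 0)}"

definition wq :: "'h::real_inner \<Rightarrow> ('h \<Rightarrow>\<^sub>L 'h) \<Rightarrow> real" where
  "wq h \<Omega> = inner (blinfun_apply \<Omega> h) h"

text \<open>Data Z_1..Z_n are the coordinates 0..n-1 of omega; n = 2*m.\<close>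
definition sample :: "'z measure \<Rightarrow> nat \<Rightarrow> (nat \<Rightarrow> 'z) measure" where
  "sample P0 m = (\<Pi>\<^sub>M i\<in>{..<2*m}. P0)"

definition train_idx :: "nat \<Rightarrow> nat \<Rightarrow> nat set" where
  "train_idx j m = (if j = 1 then {..<m} else {m..<2*m})"

definition eval_idx :: "nat \<Rightarrow> nat \<Rightarrow> nat set" where
  "eval_idx j m = (if j = 1 then {m..<2*m} else {..<m})"

definition emp :: "nat set \<Rightarrow> (nat \<Rightarrow> 'z) \<Rightarrow> ('z \<Rightarrow> 'h::real_vector) \<Rightarrow> 'h" where
  "emp A \<omega> f = (1 / real (card A)) *\<^sub>R (\<Sum>i\<in>A. f (\<omega> i))"

definition crossfit_est ::
  "('z measure \<Rightarrow> 'h::real_vector) \<Rightarrow> (nat \<Rightarrow> nat \<Rightarrow> (nat \<Rightarrow> 'z) \<Rightarrow> 'z measure)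
     \<Rightarrow> (nat \<Rightarrow> nat \<Rightarrow> (nat \<Rightarrow> 'z) \<Rightarrow> 'z \<Rightarrow> 'h) \<Rightarrow> nat \<Rightarrow> (nat \<Rightarrow> 'z) \<Rightarrow> 'h" where
  "crossfit_est \<nu> Phat phi m \<omega> =
     (1/2) *\<^sub>R (\<Sum>j\<in>{1,2::nat}. \<nu> (Phat j m \<omega>) + emp (eval_idx j m) \<omega> (phi j m \<omega>))"

definition remainder_term ::
  "('z measure \<Rightarrow> 'h::{banach,second_countable_topology}) \<Rightarrow> 'z measure \<Rightarrow> (nat \<Rightarrow> nat \<Rightarrow> (nat \<Rightarrow> 'z) \<Rightarrow> 'z measure)
     \<Rightarrow> (nat \<Rightarrow> nat \<Rightarrow> (nat \<Rightarrow> 'z) \<Rightarrow> 'z \<Rightarrow> 'h) \<Rightarrow> nat \<Rightarrow> nat \<Rightarrow> (nat \<Rightarrow> 'z) \<Rightarrow> 'h" where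
  "remainder_term \<nu> P0 Phat phi j m \<omega> =
     \<nu> (Phat j m \<omega>) + (\<integral>z. phi j m \<omega> z \<partial>P0) - \<nu> P0"

definition drift_term ::
  "'z measure \<Rightarrow> ('z \<Rightarrow> 'h::{banach,second_countable_topology}) \<Rightarrow> (nat \<Rightarrow> nat \<Rightarrow> (nat \<Rightarrow> 'z) \<Rightarrow> 'z \<Rightarrow> 'h)
     \<Rightarrow> nat \<Rightarrow> nat \<Rightarrow> (nat \<Rightarrow> 'z) \<Rightarrow> 'h" where
  "drift_term P0 \<phi>0 phi j m \<omega> =
     emp (eval_idx j m) \<omega> (\<lambda>z. phi j m \<omega> z - \<phi>0 z) - (\<integral>z. phi j m \<omega> z - \<phi>0 z \<partial>P0)"

text \<open>X_m = o_p(1 / a_m) (outer probability, so no measurability is presupposed):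
  for every e > 0, P*(a_m ||X_m|| > e) -> 0.\<close>
definition small_op :: "(nat \<Rightarrow> 'w measure) \<Rightarrow> (nat \<Rightarrow> real) \<Rightarrow> (nat \<Rightarrow> 'w \<Rightarrow> 'b::real_normed_vector) \<Rightarrow> bool" where
  "small_op S a X \<longleftrightarrow>
     (\<forall>e>0. (\<lambda>m. outer_measure_of (S m) {\<omega>\<in>space (S m). a m * norm (X m \<omega>) > e}) \<longlonglongrightarrow> 0)"

definition tight_gaussian ::
  "'a measure \<Rightarrow> ('a \<Rightarrow> 'h::{real_inner,banach,second_countable_topology}) \<Rightarrow> 'z measure \<Rightarrow> ('z \<Rightarrow> 'h) \<Rightarrow> bool" where
  "tight_gaussian Q G P0 \<phi>0 \<longleftrightarrow>
     prob_space Q \<and> G \<in> borel_measurable Q \<and>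
     (\<forall>e>0. \<exists>K. compact K \<and> measure Q (G -` K \<inter> space Q) \<ge> 1 - e) \<and>
     (\<forall>h. let v = (\<integral>z. (inner (\<phi>0 z) h)\<^sup>2 \<partial>P0) in
          distr Q borel (\<lambda>x. inner (G x) h) =
            (if v = 0 then return borel 0 else density lborel (normal_density 0 (sqrt v))))"

definition quantile_of :: "'a measure \<Rightarrow> ('a \<Rightarrow> real) \<Rightarrow> real \<Rightarrow> real" where
  "quantile_of Q W p = Inf {t. measure Q {x\<in>space Q. W x \<le> t} \<ge> p}"

end

(* Write W(x) = <Omega_0 x, x>.  The cross-fitted estimator minus the truth equals the average of
   phi_0 over the sample plus remainder and drift terms, since phi_0 has mean zero (scores of
   quadratic-mean differentiable submodels do, and this passes to the tangent space).  Hence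
   n w(nu_bar_n - nu(P_0); Omega_n) = W(S_n) + o_p(1), with S_n the scaled sum of the phi_0(Z_i).

   Weak convergence in the Hilbert space is avoided.  A Cholesky recursion over a dense sequence
   gives W(x) = sum_k <a_k, x>^2.  Since exp(-c^2) is a Gaussian average of exp(i sqrt 2 g c), the
   characteristic functions of the one-dimensional projections, for which the classical central
   limit theorem holds, determine the limit of the Laplace transform of each finite partial sum;
   the tail is controlled uniformly in n because E W(S_n) = E W(phi_0).  Convergence of the Laplace
   transform at integers gives convergence of the moments of exp(-W) in [0,1], hence of the
   distribution functions at every continuity point of the limit W(H).

   W(H) has no atoms: rotating two independent copies of H shows that an atom of mass p satisfies
   p <= p^2, and p = 1 would make a nondegenerate Gaussian bounded.  So the limiting distribution
   function is continuous and takes the value 1 - alpha at the quantile. *)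

theory Submission
  imports Defs
begin

subsection \<open>Efficient influence functions have mean zero\<close>

text \<open>A quadratic form on an infinite-dimensional space sees all coordinates at once, whereas
  the central limit theorem concerns one real functional <., h>. The Gaussian average trades a
  square <a_k, x>^2 for a random shift of h by sqrt 2 g a_k, so finitely many trades leave a single
  functional; hence the arbitrary h carried by the intermediate statements. The Cholesky expansion
  rests only on Cauchy-Schwarz and density, not on a square root or a spectral decomposition of
  Omega_0. Each tail of W is again a sum of squares, so the identity of means holds for tails too:
  centred independent summands are orthogonal, and mean zero of phi_0 is needed there as well.
  Integers suffice for the Laplace transform because exp(-W) lies in [0,1], where polynomials are
  uniformly dense. Positive definiteness of Omega_0 and phi_0 not vanishing a.e. together give a
  direction in which H is nondegenerate. The nuisance estimators need not be measurable, so they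
  meet only deterministic inequalities, and their error events are handled through measurable
  covers.\<close>

lemma (in prob_space) expectation_square_le:
  fixes f :: "'a \<Rightarrow> real"
  assumes "f \<in> borel_measurable M" "integrable M (\<lambda>x. (f x)\<^sup>2)"
  shows "(expectation f)\<^sup>2 \<le> expectation (\<lambda>x. (f x)\<^sup>2)"
proof -
  have "integrable M f" by (rule square_integrable_imp_integrable) (use assms in auto)
  then have "variance f = expectation (\<lambda>x. (f x)\<^sup>2) - (expectation f)\<^sup>2"
    using assms(2) by (rule variance_eq)
  then show ?thesis using variance_positive[of f] by simp
qed

lemma square_integrable_add:
  fixes f g :: "'a \<Rightarrow> real"
  assumes [measurable]: "f \<in> borel_measurable M" "g \<in> borel_measurable M"
    and "integrable M (\<lambda>x. (f x)\<^sup>2)" "integrable M (\<lambda>x. (g x)\<^sup>2)"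
  shows "integrable M (\<lambda>x. (f x + g x)\<^sup>2)"
proof (rule Bochner_Integration.integrable_bound)
  show "integrable M (\<lambda>x. 2 * (f x)\<^sup>2 + 2 * (g x)\<^sup>2)" using assms by simp
  have "(f x + g x)\<^sup>2 \<le> 2 * (f x)\<^sup>2 + 2 * (g x)\<^sup>2" for x
    using sum_squares_bound[of "f x" "g x"] by (simp add: power2_sum)
  then show "AE x in M. norm ((f x + g x)\<^sup>2) \<le> norm (2 * (f x)\<^sup>2 + 2 * (g x)\<^sup>2)" by simp
qed simp

lemma square_integrable_sum:
  fixes f :: "'i \<Rightarrow> 'a \<Rightarrow> real"
  assumes "finite I" "\<And>i. i \<in> I \<Longrightarrow> f i \<in> borel_measurable M"
    and "\<And>i. i \<in> I \<Longrightarrow> integrable M (\<lambda>x. (f i x)\<^sup>2)"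
  shows "integrable M (\<lambda>x. (\<Sum>i\<in>I. f i x)\<^sup>2)"
  using assms
proof (induction rule: finite_induct)
  case (insert i I)
  then have "integrable M (\<lambda>x. (f i x + (\<Sum>j\<in>I. f j x))\<^sup>2)"
    by (intro square_integrable_add borel_measurable_sum) auto
  with insert.hyps show ?case by simp
qed simp

section \<open>Densities and scores of submodels\<close>

lemma dens_nonneg: "0 \<le> dens lam P z"
  by (simp add: dens_def)

lemma borel_measurable_dens: "dens lam P \<in> borel_measurable lam"
  unfolding dens_def[abs_def] by measurable

text \<open>\<open>dens\<close> sends an infinite Radon-Nikodym value to 0. This costs nothing,
  since the derivative of a sigma-finite measure is finite almost everywhere.\<close>

lemma density_dens:
  assumes "dominated_model lam M" "P \<in> M"
  shows "density lam (\<lambda>z. ennreal (dens lam P z)) = P"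
proof -
  interpret sigma_finite_measure lam using assms by (simp add: dominated_model_def)
  interpret P: prob_space P using assms by (simp add: dominated_model_def)
  have ac: "absolutely_continuous lam P" and s: "sets P = sets lam"
    using assms by (auto simp: dominated_model_def)
  have "sigma_finite_measure P" by unfold_locales
  then have "AE z in lam. RN_deriv lam P z \<noteq> \<infinity>"
    by (rule RN_deriv_finite[OF _ ac s])
  then have "AE z in lam. ennreal (dens lam P z) = RN_deriv lam P z"
    by eventually_elim (simp add: dens_def ennreal_enn2real top.not_eq_extremum)
  then have "density lam (\<lambda>z. ennreal (dens lam P z)) = density lam (RN_deriv lam P)"
    by (intro density_cong) (auto intro!: measurable_compose[OF borel_measurable_dens])
  then show ?thesis using density_RN_deriv[OF ac s] by simp
qed

lemma
  fixes f :: "'z::topological_space \<Rightarrow> real"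
  assumes "dominated_model lam M" "P \<in> M" "f \<in> borel_measurable borel"
  shows integrable_dens: "integrable P f \<longleftrightarrow> integrable lam (\<lambda>z. dens lam P z * f z)"
    and integral_dens: "(\<integral>z. f z \<partial>P) = (\<integral>z. dens lam P z * f z \<partial>lam)"
proof -
  have sl: "sets lam = sets borel" using assms by (simp add: dominated_model_def)
  then have f: "f \<in> borel_measurable lam" using assms(3) by (simp add: measurable_cong_sets[OF sl refl])
  show "integrable P f \<longleftrightarrow> integrable lam (\<lambda>z. dens lam P z * f z)"
    using integrable_density[where M=lam and g="dens lam P" and f=f, OF f borel_measurable_dens] density_dens[OF assms(1,2)] dens_nonneg[of lam P]
    by simp
  show "(\<integral>z. f z \<partial>P) = (\<integral>z. dens lam P z * f z \<partial>lam)"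
    using integral_density[where M=lam and g="dens lam P" and f=f, OF f borel_measurable_dens] density_dens[OF assms(1,2)] dens_nonneg[of lam P]
    by simp
qed

text \<open>Let a and b be the root densities of the perturbed and the base law and r the residual
  of the expansion. Then a^2 - b^2 = e s b^2 + (a - b)^2 + 2 b r. The left side integrates to 0
  because both laws have mass one, while (a - b)^2 contributes O(e^2) and b r contributes o(e);
  dividing by e leaves only the mean of the score.\<close>

lemma score_mean_zero:
  fixes lam :: "'z::topological_space measure"
  assumes model: "dominated_model lam M" and P: "P \<in> M" and s: "is_score lam M P s"
  shows "(\<integral>z. s z \<partial>P) = 0"
proof -
  obtain Pe where q: "qmd_path lam M P Pe s" using s by (auto simp: is_score_def)
  have sl: "sets lam = sets borel" using model by (simp add: dominated_model_def)
  interpret P: prob_space P using model P by (simp add: dominated_model_def)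
  have sP: "sets P = sets borel" using model P by (simp add: dominated_model_def)
  have sb[measurable]: "s \<in> borel_measurable borel" and s2: "integrable P (\<lambda>z. (s z)\<^sup>2)"
    using q by (auto simp: qmd_path_def)
  have sl'[measurable]: "s \<in> borel_measurable lam" using sb by (simp add: measurable_cong_sets[OF sl refl])
  have sP': "s \<in> borel_measurable P" using sb by (simp add: measurable_cong_sets[OF sP refl])
  have si: "integrable P s" by (rule P.square_integrable_imp_integrable[OF sP' s2])
  note [measurable] = borel_measurable_dens
  define b where "b z = sqrt (dens lam P z)" for z
  have b2: "(b z)\<^sup>2 = dens lam P z" for z by (simp add: b_def dens_nonneg)
  have bm[measurable]: "b \<in> borel_measurable lam" unfolding b_def[abs_def] by measurable
  define E where "E = (\<integral>z. s z \<partial>P)"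
  define S where "S = (\<integral>z. (s z)\<^sup>2 \<partial>P)"
  have ib: "integrable lam (\<lambda>z. (b z)\<^sup>2)" "(\<integral>z. (b z)\<^sup>2 \<partial>lam) = 1"
    using integrable_dens[OF model P, of "\<lambda>_. 1"] integral_dens[OF model P, of "\<lambda>_. 1"]
    by (auto simp: b2 P.prob_space)
  have isb: "integrable lam (\<lambda>z. (b z)\<^sup>2 * s z)" "(\<integral>z. (b z)\<^sup>2 * s z \<partial>lam) = E"
    using integrable_dens[OF model P sb] integral_dens[OF model P sb] si by (auto simp: b2 E_def)
  have is2b: "integrable lam (\<lambda>z. (b z)\<^sup>2 * (s z)\<^sup>2)" "(\<integral>z. (b z)\<^sup>2 * (s z)\<^sup>2 \<partial>lam) = S"
    using integrable_dens[OF model P, of "\<lambda>z. (s z)\<^sup>2"] integral_dens[OF model P, of "\<lambda>z. (s z)\<^sup>2"] s2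
    by (auto simp: b2 S_def)
  have bound: "\<bar>E\<bar> \<le> 2 * k" if k: "k > 0" for k
  proof -
    \<comment> \<open>The tolerance \<open>k\<^sup>2\<close> for the squared residual makes its norm
      at most k |e|. The coefficient of |e| collects the terms from (a - b)^2, and
      \<open>2 * k\<close> comes from the cross term 2 b r.\<close>
    have "\<forall>\<^sub>F e in at 0. \<bar>E\<bar> \<le> (2 * k\<^sup>2 + S / 2) * \<bar>e\<bar> + 2 * k"
    proof -
      have 1: "\<forall>\<^sub>F e in at 0. Pe e \<in> M"
        using q unfolding qmd_path_def by (auto simp: eventually_at_filter elim: eventually_mono)
      have 2: "\<forall>\<^sub>F e in at 0.
        (\<integral>\<^sup>+ z. ennreal ((sqrt (dens lam (Pe e) z) - sqrt (dens lam P z)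
                             - e * s z * sqrt (dens lam P z) / 2)\<^sup>2) \<partial>lam)
        \<le> ennreal (k\<^sup>2 * e\<^sup>2)"
        using q k unfolding qmd_path_def by simp
      have 3: "\<forall>\<^sub>F e in at 0. (e::real) \<noteq> 0" by (rule eventually_neq_at_within)
      from 1 2 3 show ?thesis
      proof eventually_elim
        case (elim e)
        interpret Pe: prob_space "Pe e" using model elim(1) by (simp add: dominated_model_def)
        define a where "a z = sqrt (dens lam (Pe e) z)" for z
        have a2: "(a z)\<^sup>2 = dens lam (Pe e) z" for z by (simp add: a_def dens_nonneg)
        have am[measurable]: "a \<in> borel_measurable lam" unfolding a_def[abs_def] by measurable
        have ia: "integrable lam (\<lambda>z. (a z)\<^sup>2)" "(\<integral>z. (a z)\<^sup>2 \<partial>lam) = 1"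
          using integrable_dens[OF model elim(1), of "\<lambda>_. 1"] integral_dens[OF model elim(1), of "\<lambda>_. 1"]
          by (auto simp: a2 Pe.prob_space)
        define r where "r z = a z - b z - e * s z * b z / 2" for z
        have rm[measurable]: "r \<in> borel_measurable lam" unfolding r_def[abs_def] by measurable
        have rn: "(\<integral>\<^sup>+ z. ennreal ((r z)\<^sup>2) \<partial>lam) \<le> ennreal (k\<^sup>2 * e\<^sup>2)"
          using elim(2) by (simp add: r_def a_def b_def)
        have ir: "integrable lam (\<lambda>z. (r z)\<^sup>2)"
          using order.strict_trans1[OF rn ennreal_less_top] by (intro integrableI_bounded) auto
        have ir': "(\<integral>z. (r z)\<^sup>2 \<partial>lam) \<le> k\<^sup>2 * e\<^sup>2"
          by (rule integral_real_bounded) (use rn in auto)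
        have pt: "\<bar>e * ((b z)\<^sup>2 * s z) - ((a z)\<^sup>2 - (b z)\<^sup>2)\<bar>
            \<le> 2 * (r z)\<^sup>2 + (e\<^sup>2 / 2) * ((b z)\<^sup>2 * (s z)\<^sup>2) + (1 / (k * \<bar>e\<bar>)) * (r z)\<^sup>2 + (k * \<bar>e\<bar>) * (b z)\<^sup>2" for z
        proof -
          have i: "e * ((b z)\<^sup>2 * s z) - ((a z)\<^sup>2 - (b z)\<^sup>2) = - ((a z - b z)\<^sup>2 + 2 * (b z * r z))"
            by (simp add: r_def power2_eq_square field_simps)
          have "(a z - b z)\<^sup>2 = (r z + e * s z * b z / 2)\<^sup>2" by (simp add: r_def)
          also have "\<dots> \<le> 2 * (r z)\<^sup>2 + 2 * (e * s z * b z / 2)\<^sup>2"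
            using sum_squares_bound[of "r z" "e * s z * b z / 2"] unfolding power2_sum by linarith
          also have "2 * (e * s z * b z / 2)\<^sup>2 = (e\<^sup>2 / 2) * ((b z)\<^sup>2 * (s z)\<^sup>2)"
            by (simp add: power2_eq_square)
          finally have ii: "(a z - b z)\<^sup>2 \<le> 2 * (r z)\<^sup>2 + (e\<^sup>2 / 2) * ((b z)\<^sup>2 * (s z)\<^sup>2)" .
          \<comment> \<open>Weight for the AM-GM splitting of 2 b r: since r^2 has integral at most
            k^2 e^2 and b^2 has integral 1, it balances both parts at k |e|.\<close>
          let ?q = "sqrt (k * \<bar>e\<bar>)"
          have q: "?q > 0" "?q\<^sup>2 = k * \<bar>e\<bar>" using k elim(3) by auto
          have "2 * \<bar>r z / ?q\<bar> * \<bar>?q * b z\<bar> \<le> \<bar>r z / ?q\<bar>\<^sup>2 + \<bar>?q * b z\<bar>\<^sup>2" by (rule sum_squares_bound)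
          also have "2 * \<bar>r z / ?q\<bar> * \<bar>?q * b z\<bar> = \<bar>2 * (b z * r z)\<bar>" using k elim(3) by (simp add: abs_mult)
          also have "\<bar>r z / ?q\<bar>\<^sup>2 + \<bar>?q * b z\<bar>\<^sup>2 = (1 / (k * \<bar>e\<bar>)) * (r z)\<^sup>2 + (k * \<bar>e\<bar>) * (b z)\<^sup>2"
            unfolding power2_abs power_divide power_mult_distrib q(2) by simp
          finally have iii: "\<bar>2 * (b z * r z)\<bar> \<le> (1 / (k * \<bar>e\<bar>)) * (r z)\<^sup>2 + (k * \<bar>e\<bar>) * (b z)\<^sup>2" .
          have "0 \<le> (a z - b z)\<^sup>2" by simp
          with i ii iii show ?thesis by linarith
        qed
        have "\<bar>e * E\<bar> = \<bar>\<integral>z. e * ((b z)\<^sup>2 * s z) - ((a z)\<^sup>2 - (b z)\<^sup>2) \<partial>lam\<bar>"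
          using isb ia ib by simp
        also have "\<dots> \<le> (\<integral>z. 2 * (r z)\<^sup>2 + (e\<^sup>2 / 2) * ((b z)\<^sup>2 * (s z)\<^sup>2)
             + (1 / (k * \<bar>e\<bar>)) * (r z)\<^sup>2 + (k * \<bar>e\<bar>) * (b z)\<^sup>2 \<partial>lam)"
          by (rule integral_abs_bound[THEN order_trans], rule integral_mono)
             (use isb ia ib is2b ir pt in auto)
        also have "\<dots> = 2 * (\<integral>z. (r z)\<^sup>2 \<partial>lam) + (e\<^sup>2 / 2) * S
            + (1 / (k * \<bar>e\<bar>)) * (\<integral>z. (r z)\<^sup>2 \<partial>lam) + (k * \<bar>e\<bar>)"
          using ib is2b ir by simp
        also have "\<dots> \<le> 2 * (k\<^sup>2 * e\<^sup>2) + (e\<^sup>2 / 2) * S + (1 / (k * \<bar>e\<bar>)) * (k\<^sup>2 * e\<^sup>2) + (k * \<bar>e\<bar>)"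
          using ir' k by (intro add_mono mult_left_mono) auto
        also have "\<dots> = \<bar>e\<bar> * ((2 * k\<^sup>2 + S / 2) * \<bar>e\<bar> + 2 * k)"
          using k elim(3) by (simp add: field_simps power2_eq_square abs_mult[symmetric])
        finally show ?case using elim(3) by (simp add: abs_mult)
      qed
    qed
    moreover have "((\<lambda>e. (2 * k\<^sup>2 + S / 2) * \<bar>e\<bar> + 2 * k) \<longlongrightarrow> (2 * k\<^sup>2 + S / 2) * \<bar>0\<bar> + 2 * k) (at 0)"
      by (intro tendsto_intros)
    ultimately show ?thesis
      using tendsto_lowerbound[of "\<lambda>e. (2 * k\<^sup>2 + S / 2) * \<bar>e\<bar> + 2 * k" _ "at (0::real)" "\<bar>E\<bar>"] by simp
  qed
  have "\<bar>E\<bar> \<le> 0"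
    by (rule field_le_epsilon) (use bound[of "_ / 2"] in auto)
  then show ?thesis by (simp add: E_def)
qed

text \<open>The mean is continuous in L2(P): its square is at most the mean square. Subtracting a
  finite combination of scores leaves the mean unchanged and makes the mean square arbitrarily
  small.\<close>

lemma tangent_space_mean_zero:
  fixes lam :: "'z::topological_space measure"
  assumes model: "dominated_model lam M" and P: "P \<in> M" and f: "f \<in> tangent_space lam M P"
  shows "(\<integral>z. f z \<partial>P) = 0"
proof -
  interpret P: prob_space P using model P by (simp add: dominated_model_def)
  have sP[measurable_cong]: "sets P = sets borel" using model P by (simp add: dominated_model_def)
  have fm[measurable]: "f \<in> borel_measurable borel" and f2: "integrable P (\<lambda>z. (f z)\<^sup>2)"
    using f by (auto simp: tangent_space_def)
  have fi: "integrable P f" by (rule P.square_integrable_imp_integrable[OF _ f2]) measurable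
  have "(\<integral>z. f z \<partial>P)\<^sup>2 \<le> 0 + c" if "c > 0" for c
  proof -
    obtain k :: nat and a :: "nat \<Rightarrow> real" and s :: "nat \<Rightarrow> 'z \<Rightarrow> real"
      where s: "\<forall>i<k. is_score lam M P (s i)"
      and c: "(\<integral>z. (f z - (\<Sum>i<k. a i * s i z))\<^sup>2 \<partial>P) < c"
      using f \<open>c > 0\<close> unfolding tangent_space_def by blast
    have sm: "s i \<in> borel_measurable P" and s2: "integrable P (\<lambda>z. (s i z)\<^sup>2)" if "i < k" for i
      using s that by (auto simp: is_score_def qmd_path_def measurable_cong_sets[OF sP refl])
    have si: "integrable P (s i)" if "i < k" for i
      by (rule P.square_integrable_imp_integrable[OF sm s2]) (use that in auto)
    let ?g = "\<lambda>z. \<Sum>i<k. a i * s i z"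
    have gm[measurable]: "?g \<in> borel_measurable P" using sm by auto
    have g2: "integrable P (\<lambda>z. (?g z)\<^sup>2)"
      by (rule square_integrable_sum) (use sm s2 in \<open>auto simp: power_mult_distrib\<close>)
    have gi: "integrable P ?g" using si by auto
    have "(\<integral>z. ?g z \<partial>P) = 0"
      using si s score_mean_zero[OF model P] by (simp add: Bochner_Integration.integral_sum)
    then have "(\<integral>z. f z \<partial>P)\<^sup>2 = (\<integral>z. f z - ?g z \<partial>P)\<^sup>2" using fi gi by simp
    also have "\<dots> \<le> (\<integral>z. (f z - ?g z)\<^sup>2 \<partial>P)"
      using square_integrable_add[of f P "\<lambda>z. - ?g z"] f2 g2
      by (intro P.expectation_square_le) auto
    finally show ?thesis using c by simp
  qed
  then have "(\<integral>z. f z \<partial>P)\<^sup>2 \<le> 0" by (rule field_le_epsilon)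
  then show ?thesis by simp
qed

text \<open>Every functional \<open>inner h (\<phi> z)\<close> lies in the tangent space, so the
  Bochner mean is orthogonal to all h, in particular to itself.\<close>

lemma EIF_mean_zero:
  fixes \<phi> :: "'z::topological_space \<Rightarrow> 'h::{real_inner,banach,second_countable_topology}"
  assumes model: "dominated_model lam M" and P: "P \<in> M"
    and eif: "is_EIF lam M \<nu> P \<phi>" and i: "integrable P \<phi>"
  shows "(\<integral>z. \<phi> z \<partial>P) = 0"
proof -
  have "inner h (\<integral>z. \<phi> z \<partial>P) = 0" for h
  proof -
    have "(\<lambda>z. inner h (\<phi> z)) \<in> tangent_space lam M P" using eif by (auto simp: is_EIF_def)
    from tangent_space_mean_zero[OF model P this] show ?thesis using i by simp
  qed
  from this[of "\<integral>z. \<phi> z \<partial>P"] show ?thesis by simp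
qed

subsection \<open>Quadratic forms as sums of squares of functionals\<close>

lemma ex_dense_sequence:
  "\<exists>d :: nat \<Rightarrow> 'h::{metric_space,second_countable_topology}. \<forall>x. \<forall>e>0. \<exists>k. dist x (d k) < e"
proof -
  obtain D :: "'h set" where D: "countable D" "\<And>X. open X \<Longrightarrow> X \<noteq> {} \<Longrightarrow> \<exists>d\<in>D. d \<in> X"
    by (rule countable_dense_setE) blast
  have "D \<noteq> {}" using D(2)[of UNIV] by auto
  have "\<exists>k. dist x (from_nat_into D k) < e" if "e > 0" for x e
  proof -
    obtain y where "y \<in> D" "y \<in> ball x e" using D(2)[of "ball x e"] \<open>e > 0\<close> by auto
    moreover obtain k where "from_nat_into D k = y" using from_nat_into_surj[OF D(1) \<open>y \<in> D\<close>] by auto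
    ultimately show ?thesis by auto
  qed
  then show ?thesis by blast
qed

text \<open>Bare functions instead of bounded operators: the Cholesky residuals stay in this class
  without carrying a norm bound, and continuity is only ever required of the initial
  operator.\<close>

definition psd_op :: "('h::real_inner \<Rightarrow> 'h) \<Rightarrow> bool" where
  "psd_op T \<longleftrightarrow> linear T \<and> (\<forall>x y. inner (T x) y = inner x (T y)) \<and> (\<forall>x. inner (T x) x \<ge> 0)"

lemma psd_op_add: "psd_op T \<Longrightarrow> T (x + y) = T x + T y"
  by (simp add: psd_op_def linear_add)

lemma psd_op_scale: "psd_op T \<Longrightarrow> T (c *\<^sub>R x) = c *\<^sub>R T x"
  by (simp add: psd_op_def linear_cmul)

lemma psd_op_commute: "psd_op T \<Longrightarrow> inner (T x) y = inner (T y) x"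
  by (simp add: psd_op_def inner_commute)

lemma psd_op_nonneg: "psd_op T \<Longrightarrow> inner (T x) x \<ge> 0"
  unfolding psd_op_def by blast

lemma psd_op_quad_add:
  assumes "psd_op T"
  shows "inner (T (x + y)) (x + y) = inner (T x) x + 2 * inner (T x) y + inner (T y) y"
  using psd_op_commute[OF assms, of x y]
  by (simp add: psd_op_add[OF assms] inner_add_left inner_add_right)

text \<open>The form may be degenerate, so the usual minimization along x + c y needs a separate
  case. If the form vanishes at y, it is affine in c along that line, and nonnegativity forces zero
  slope.\<close>

lemma psd_op_Cauchy_Schwarz:
  assumes T: "psd_op T"
  shows "(inner (T x) y)\<^sup>2 \<le> inner (T x) x * inner (T y) y"
proof (cases "inner (T y) y = 0")
  case True
  have "inner (T x) y = 0"
  proof (rule ccontr)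
    assume n: "inner (T x) y \<noteq> 0"
    \<comment> \<open>Chosen so that the affine function of c takes the value -1.\<close>
    define c where "c = - (inner (T x) x + 1) / (2 * inner (T x) y)"
    have "0 \<le> inner (T (x + c *\<^sub>R y)) (x + c *\<^sub>R y)" by (rule psd_op_nonneg[OF T])
    also have "\<dots> = inner (T x) x + 2 * (c * inner (T x) y)"
      by (simp add: psd_op_quad_add[OF T] psd_op_scale[OF T] True)
    also have "c * inner (T x) y = - (inner (T x) x + 1) / 2" using n by (simp add: c_def)
    also have "inner (T x) x + 2 * (- (inner (T x) x + 1) / 2) = -1" by (simp add: field_simps)
    finally show False by simp
  qed
  with True show ?thesis by simp
next
  case False
  then have pos: "inner (T y) y > 0" using psd_op_nonneg[OF T, of y] by simp
  define c where "c = - inner (T x) y / inner (T y) y"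
  have "0 \<le> inner (T (x + c *\<^sub>R y)) (x + c *\<^sub>R y)" by (rule psd_op_nonneg[OF T])
  also have "\<dots> = inner (T x) x + 2 * (c * inner (T x) y) + c * c * inner (T y) y"
    by (simp add: psd_op_quad_add[OF T] psd_op_scale[OF T])
  also have "\<dots> = inner (T x) x - (inner (T x) y)\<^sup>2 / inner (T y) y"
    using pos by (simp add: c_def field_simps power2_eq_square)
  finally show ?thesis using pos by (simp add: field_simps)
qed

text \<open>One step of a Cholesky decomposition: eliminate the direction \<open>d\<close>.  If the quadratic form
  vanishes at \<open>d\<close>, then \<open>T d = 0\<close>, and the division by zero does no harm.\<close>
definition chol_step :: "'h::real_inner \<Rightarrow> ('h \<Rightarrow> 'h) \<Rightarrow> 'h \<Rightarrow> 'h" where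
  "chol_step d T x = T x - (inner (T d) x / inner (T d) d) *\<^sub>R T d"

lemma chol_step_quad:
  "inner (chol_step d T x) x = inner (T x) x - (inner ((1 / sqrt (inner (T d) d)) *\<^sub>R T d) x)\<^sup>2"
  if "psd_op T"
  using psd_op_nonneg[OF that, of d]
  by (simp add: chol_step_def inner_diff_left power_divide power2_eq_square power_mult_distrib)

text \<open>The residual is a Schur complement; its nonnegativity is exactly Cauchy-Schwarz for the
  form at d and x.\<close>

lemma psd_op_chol_step:
  assumes T: "psd_op T"
  shows "psd_op (chol_step d T)"
  unfolding psd_op_def
proof (intro conjI allI)
  show "linear (chol_step d T)"
    by (rule linearI)
       (simp_all add: chol_step_def psd_op_add[OF T] psd_op_scale[OF T] inner_add_right
          add_divide_distrib algebra_simps)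
  show "inner (chol_step d T x) y = inner x (chol_step d T y)" for x y
    using psd_op_commute[OF T, of x y]
    by (simp add: chol_step_def inner_diff_left inner_diff_right inner_commute mult.commute)
  show "inner (chol_step d T x) x \<ge> 0" for x
  proof -
    have "(inner (T d) x)\<^sup>2 \<le> inner (T d) d * inner (T x) x" by (rule psd_op_Cauchy_Schwarz[OF T])
    then have "(inner (T d) x)\<^sup>2 / inner (T d) d \<le> inner (T x) x"
      using psd_op_nonneg[OF T, of d] psd_op_nonneg[OF T, of x]
      by (cases "inner (T d) d = 0") (simp_all add: field_simps)
    then show ?thesis by (simp add: chol_step_def inner_diff_left power2_eq_square)
  qed
qed

lemma chol_step_kill:
  assumes T: "psd_op T"
  shows "inner (chol_step d T d) d = 0"
  by (cases "inner (T d) d = 0") (simp_all add: chol_step_def inner_diff_left)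

lemma chol_step_le:
  assumes T: "psd_op T"
  shows "inner (chol_step d T x) x \<le> inner (T x) x"
  by (simp add: chol_step_quad[OF T])

primrec chol :: "(nat \<Rightarrow> 'h::real_inner) \<Rightarrow> ('h \<Rightarrow> 'h) \<Rightarrow> nat \<Rightarrow> 'h \<Rightarrow> 'h" where
  "chol d T 0 = T"
| "chol d T (Suc k) = chol_step (d k) (chol d T k)"

lemma psd_op_chol: "psd_op T \<Longrightarrow> psd_op (chol d T k)"
  by (induction k) (simp_all add: psd_op_chol_step)

text \<open>Column k of the Cholesky factor: the pivot column divided by the root of its pivot. A
  zero pivot gives the zero vector, because \<open>1 / sqrt 0 = 0\<close>.\<close>

definition chol_vec :: "(nat \<Rightarrow> 'h::real_inner) \<Rightarrow> ('h \<Rightarrow> 'h) \<Rightarrow> nat \<Rightarrow> 'h" where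
  "chol_vec d T k = (1 / sqrt (inner (chol d T k (d k)) (d k))) *\<^sub>R chol d T k (d k)"

lemma chol_quad:
  assumes "psd_op T"
  shows "inner (T x) x = (\<Sum>k<K. (inner (chol_vec d T k) x)\<^sup>2) + inner (chol d T K x) x"
  by (induction K)
     (simp_all add: chol_step_quad[OF psd_op_chol[OF assms]] chol_vec_def)

lemma chol_antimono:
  assumes T: "psd_op T" and "j \<le> k"
  shows "inner (chol d T k x) x \<le> inner (chol d T j x) x"
  using \<open>j \<le> k\<close>
proof (induction k rule: dec_induct)
  case (step n)
  then show ?case using chol_step_le[OF psd_op_chol[OF T], of "d n" d n x] by simp
qed simp

text \<open>Once step j is done the residual form vanishes at \<open>d j\<close>, and it stays zero
  because residuals decrease. By Cauchy-Schwarz such a point can be subtracted from the argument, so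
  the residual at x equals the residual at \<open>x - d j\<close>, which is at most C times the
  squared norm of \<open>x - d j\<close>. Density makes this arbitrarily small.\<close>

lemma quad_form_sums:
  fixes T :: "'h::{real_inner,second_countable_topology} \<Rightarrow> 'h"
  assumes T: "psd_op T" and bT: "bounded_linear T"
  shows "\<exists>a. \<forall>x. (\<lambda>k. (inner (a k) x)\<^sup>2) sums inner (T x) x"
proof -
  obtain d :: "nat \<Rightarrow> 'h" where d: "\<And>x e. e > 0 \<Longrightarrow> \<exists>k. dist x (d k) < e"
    using ex_dense_sequence by metis
  obtain C where C: "C > 0" "\<And>x. norm (T x) \<le> norm x * C"
    using bounded_linear.pos_bounded[OF bT] by blast
  have "(\<lambda>k. (inner (chol_vec d T k) x)\<^sup>2) sums inner (T x) x" for x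
  proof -
    have lim: "(\<lambda>K. inner (chol d T K x) x) \<longlonglongrightarrow> 0"
    proof (rule LIMSEQ_I)
      fix r :: real assume "r > 0"
      then obtain j where j: "dist x (d j) < sqrt (r / C)" using d[of "sqrt (r / C)" x] C(1) by auto
      define y where "y = x - d j"
      have "(norm y)\<^sup>2 < (sqrt (r / C))\<^sup>2"
        using j by (intro power_strict_mono) (auto simp: y_def dist_norm)
      then have "(norm y)\<^sup>2 < r / C" using \<open>r > 0\<close> C(1) by simp
      then have y: "(norm y)\<^sup>2 * C < r" using C(1) by (simp add: field_simps)
      have "norm (inner (chol d T K x) x - 0) < r" if "K \<ge> Suc j" for K
      proof -
        note cK = psd_op_chol[OF T, of d K]
        have "inner (chol d T K (d j)) (d j) \<le> 0"
          using chol_antimono[OF T that, of d "d j"]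
            chol_step_kill[OF psd_op_chol[OF T, of d j], of "d j"] by simp
        then have z: "inner (chol d T K (d j)) (d j) = 0" using psd_op_nonneg[OF cK, of "d j"] by simp
        have z2: "inner (chol d T K (d j)) y = 0"
          using psd_op_Cauchy_Schwarz[OF cK, of "d j" y] by (simp add: z)
        have "inner (chol d T K x) x = inner (chol d T K (d j + y)) (d j + y)" by (simp add: y_def)
        also have "\<dots> = inner (chol d T K y) y" by (simp add: psd_op_quad_add[OF cK] z z2)
        also have "\<dots> \<le> inner (T y) y" using chol_antimono[OF T, of 0 K d y] by simp
        also have "\<dots> \<le> norm (T y) * norm y" by (rule norm_cauchy_schwarz)
        also have "\<dots> \<le> (norm y * C) * norm y" by (intro mult_right_mono C) simp
        also have "\<dots> = (norm y)\<^sup>2 * C" by (simp add: power2_eq_square)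
        finally show ?thesis using y psd_op_nonneg[OF cK, of x] by simp
      qed
      then show "\<exists>no. \<forall>K\<ge>no. norm (inner (chol d T K x) x - 0) < r" by blast
    qed
    have "(\<lambda>K. \<Sum>k<K. (inner (chol_vec d T k) x)\<^sup>2) = (\<lambda>K. inner (T x) x - inner (chol d T K x) x)"
      using chol_quad[OF T, of x d] by (metis add_diff_cancel_right')
    moreover have "(\<lambda>K. inner (T x) x - inner (chol d T K x) x) \<longlonglongrightarrow> inner (T x) x - 0"
      by (intro tendsto_intros lim)
    ultimately show ?thesis by (simp add: sums_def)
  qed
  then show ?thesis by blast
qed

lemma psd_op_op_class:
  assumes "\<Omega> \<in> op_class" shows "psd_op (blinfun_apply \<Omega>)"
  unfolding psd_op_def
proof (intro conjI allI)
  show "linear (blinfun_apply \<Omega>)" by (rule bounded_linear.linear[OF blinfun.bounded_linear_right])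
  show "inner (blinfun_apply \<Omega> x) y = inner x (blinfun_apply \<Omega> y)" for x y
    using assms by (simp add: op_class_def)
  show "inner (blinfun_apply \<Omega> x) x \<ge> 0" for x
    using assms by (cases "x = 0") (auto simp: op_class_def less_imp_le)
qed

lemma wq_sums:
  fixes \<Omega> :: "'h::{real_inner,second_countable_topology} \<Rightarrow>\<^sub>L 'h"
  assumes "\<Omega> \<in> op_class"
  shows "\<exists>a. \<forall>x. (\<lambda>k. (inner (a k) x)\<^sup>2) sums wq x \<Omega>"
  unfolding wq_def by (rule quad_form_sums[OF psd_op_op_class[OF assms]]) (rule blinfun.bounded_linear_right)

subsection \<open>Laplace transforms and distribution functions\<close>

text \<open>The method of moments on [0,1]: replace f by a uniformly close polynomial, whose
  integral is a finite combination of moments.\<close>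

lemma moments_imp_integral_tendsto:
  fixes U :: "nat \<Rightarrow> 'w \<Rightarrow> real" and V :: "'a \<Rightarrow> real" and f :: "real \<Rightarrow> real"
  assumes N: "\<And>n. prob_space (N n)" and U: "\<And>n. U n \<in> borel_measurable (N n)" "\<And>n \<omega>. U n \<omega> \<in> {0..1}"
    and Q: "prob_space Q" and V: "V \<in> borel_measurable Q" "\<And>x. V x \<in> {0..1}"
    and lim: "\<And>i::nat. (\<lambda>n. \<integral>\<omega>. U n \<omega> ^ i \<partial>N n) \<longlonglongrightarrow> (\<integral>x. V x ^ i \<partial>Q)"
    and f: "continuous_on UNIV f"
  shows "(\<lambda>n. \<integral>\<omega>. f (U n \<omega>) \<partial>N n) \<longlonglongrightarrow> (\<integral>x. f (V x) \<partial>Q)"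
proof (rule LIMSEQ_I)
  fix r :: real assume r: "r > 0"
  have fm: "f \<in> borel_measurable borel" using f by (rule borel_measurable_continuous_onI)
  have "continuous_on {0..1} f" by (rule continuous_on_subset[OF f]) simp
  then obtain g where g: "real_polynomial_function g" "\<And>x. x \<in> {0..1} \<Longrightarrow> \<bar>f x - g x\<bar> < r / 3"
    using Stone_Weierstrass_real_polynomial_function[of "{0..1::real}" f "r / 3"] r by auto
  then obtain a d where gd: "g = (\<lambda>x. \<Sum>i\<le>d. a i * x ^ i)"
    using real_polynomial_function_iff_sum by blast
  have gm: "g \<in> borel_measurable borel" unfolding gd by measurable
  have bound: "\<exists>B. \<forall>x\<in>{0..1}. \<bar>h x\<bar> \<le> B" if "continuous_on {0..1} h" for h :: "real \<Rightarrow> real"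
  proof -
    have "bounded (h ` {0..1})" by (intro compact_imp_bounded compact_continuous_image that) simp
    then show ?thesis by (auto simp: bounded_iff)
  qed
  obtain B1 where B1: "\<And>x. x \<in> {0..1} \<Longrightarrow> \<bar>f x\<bar> \<le> B1" using bound[OF \<open>continuous_on {0..1} f\<close>] by blast
  have "continuous_on {0..1} g" unfolding gd by (intro continuous_intros)
  then obtain B2 where B2: "\<And>x. x \<in> {0..1} \<Longrightarrow> \<bar>g x\<bar> \<le> B2" using bound by blast
  \<comment> \<open>Stated for an arbitrary probability space, so that it serves the sequence
    (uniformly in n) and the limit alike.\<close>
  have close: "\<bar>(\<integral>\<omega>. f (X \<omega>) \<partial>M) - (\<Sum>i\<le>d. a i * (\<integral>\<omega>. X \<omega> ^ i \<partial>M))\<bar> \<le> r / 3"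
    if M: "prob_space M" and X: "X \<in> borel_measurable M" and X1: "\<And>\<omega>. X \<omega> \<in> {0..1}"
    for M :: "'b measure" and X
  proof -
    interpret prob_space M by (rule M)
    note [measurable] = fm gm X
    have if': "integrable M (\<lambda>\<omega>. f (X \<omega>))" by (rule integrable_const_bound[of _ B1]) (use B1 X1 in auto)
    have ig: "integrable M (\<lambda>\<omega>. g (X \<omega>))" by (rule integrable_const_bound[of _ B2]) (use B2 X1 in auto)
    have ip: "integrable M (\<lambda>\<omega>. X \<omega> ^ i)" for i
      by (rule integrable_const_bound[of _ 1]) (use X1 in \<open>auto simp: power_le_one\<close>)
    have "(\<integral>\<omega>. g (X \<omega>) \<partial>M) = (\<Sum>i\<le>d. a i * (\<integral>\<omega>. X \<omega> ^ i \<partial>M))"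
      unfolding gd using ip by simp
    moreover have "\<bar>\<integral>\<omega>. f (X \<omega>) - g (X \<omega>) \<partial>M\<bar> \<le> (\<integral>\<omega>. r / 3 \<partial>M)"
      by (rule integral_abs_bound[THEN order_trans], rule integral_mono)
         (use if' ig g(2)[OF X1] in \<open>auto intro: less_imp_le\<close>)
    ultimately show ?thesis using if' ig by (simp add: prob_space)
  qed
  have "(\<lambda>n. \<Sum>i\<le>d. a i * (\<integral>\<omega>. U n \<omega> ^ i \<partial>N n)) \<longlonglongrightarrow> (\<Sum>i\<le>d. a i * (\<integral>x. V x ^ i \<partial>Q))"
    by (intro tendsto_intros lim)
  then obtain n0 where n0: "\<And>n. n \<ge> n0 \<Longrightarrow>
      \<bar>(\<Sum>i\<le>d. a i * (\<integral>\<omega>. U n \<omega> ^ i \<partial>N n)) - (\<Sum>i\<le>d. a i * (\<integral>x. V x ^ i \<partial>Q))\<bar> < r / 3"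
    using LIMSEQ_D[of _ _ "r / 3"] r by (fastforce simp: real_norm_def)
  have "norm ((\<integral>\<omega>. f (U n \<omega>) \<partial>N n) - (\<integral>x. f (V x) \<partial>Q)) < r" if "n \<ge> n0" for n
  proof -
    note close[OF N[of n] U(1)[of n] U(2)[of n]] close[OF Q V] n0[OF that]
    then show ?thesis unfolding real_norm_def by linarith
  qed
  then show "\<exists>no. \<forall>n\<ge>no. norm ((\<integral>\<omega>. f (U n \<omega>) \<partial>N n) - (\<integral>x. f (V x) \<partial>Q)) < r" by blast
qed

text \<open>Laplace transforms at integers are the moments of exp(-W), so expectations of continuous
  functions of exp(-W) converge. Testing with continuous step functions gives weak convergence, and
  the missing atom at c makes the transformed point a continuity point of the limit.\<close>

lemma Laplace_imp_cdf_tendsto: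
  fixes W :: "nat \<Rightarrow> 'w \<Rightarrow> real" and V :: "'a \<Rightarrow> real"
  assumes N: "\<And>n. prob_space (N n)" and W: "\<And>n. W n \<in> borel_measurable (N n)" "\<And>n \<omega>. W n \<omega> \<ge> 0"
    and Q: "prob_space Q" and V: "V \<in> borel_measurable Q" "\<And>x. V x \<ge> 0"
    and lim: "\<And>t::nat. (\<lambda>n. \<integral>\<omega>. exp (- (real t * W n \<omega>)) \<partial>N n) \<longlonglongrightarrow> (\<integral>x. exp (- (real t * V x)) \<partial>Q)"
    and atom: "measure Q {x \<in> space Q. V x = c} = 0"
  shows "(\<lambda>n. measure (N n) {\<omega> \<in> space (N n). W n \<omega> \<le> c}) \<longlonglongrightarrow> measure Q {x \<in> space Q. V x \<le> c}"
proof -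
  note [measurable] = W(1) V(1)
  \<comment> \<open>The outer minus sign makes the transformation increasing, so the event W <= c
    becomes a lower half-line and no complement has to be taken.\<close>
  define \<mu> where "\<mu> n = distr (N n) borel (\<lambda>\<omega>. - exp (- W n \<omega>))" for n
  define \<mu>' where "\<mu>' = distr Q borel (\<lambda>x. - exp (- V x))"
  have rd: "real_distribution (\<mu> n)" for n
    unfolding \<mu>_def by (rule prob_space.real_distribution_distr[OF N]) measurable
  have rd': "real_distribution \<mu>'"
    unfolding \<mu>'_def by (rule prob_space.real_distribution_distr[OF Q]) measurable
  have pw: "exp (- (real t * x)) = exp (- x) ^ t" for t and x :: real
    by (simp add: exp_of_nat_mult[symmetric])
  have "weak_conv_m \<mu> \<mu>'"
  proof (rule integral_cts_step_conv_imp_weak_conv[OF rd rd'])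
    fix x y :: real assume xy: "x < y"
    have c: "continuous_on UNIV (cts_step x y)"
      by (rule uniformly_continuous_imp_continuous[OF cts_step_uniformly_continuous[OF xy]])
    have c': "continuous_on UNIV (\<lambda>u. cts_step x y (- u))"
      by (rule continuous_on_compose2[OF c]) (auto intro!: continuous_intros)
    have [measurable]: "cts_step x y \<in> borel_measurable borel"
      using c by (rule borel_measurable_continuous_onI)
    have "(\<lambda>n. \<integral>\<omega>. cts_step x y (- exp (- W n \<omega>)) \<partial>N n) \<longlonglongrightarrow> (\<integral>z. cts_step x y (- exp (- V z)) \<partial>Q)"
      by (rule moments_imp_integral_tendsto[OF N _ _ Q _ _ _ c'])
         (use W V lim in \<open>auto simp: pw\<close>)
    then show "(\<lambda>n. integral\<^sup>L (\<mu> n) (cts_step x y)) \<longlonglongrightarrow> integral\<^sup>L \<mu>' (cts_step x y)"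
      by (simp add: \<mu>_def \<mu>'_def integral_distr)
  qed
  moreover have "isCont (cdf \<mu>') (- exp (- c))"
  proof -
    interpret real_distribution \<mu>' by (rule rd')
    have "measure \<mu>' {- exp (- c)} = measure Q {x \<in> space Q. V x = c}"
      unfolding \<mu>'_def by (subst measure_distr) (auto intro!: arg_cong[where f="measure Q"])
    then show ?thesis using atom by (simp add: isCont_cdf)
  qed
  moreover have "cdf (\<mu> n) (- exp (- c)) = measure (N n) {\<omega> \<in> space (N n). W n \<omega> \<le> c}" for n
    unfolding \<mu>_def cdf_def by (subst measure_distr) (auto intro!: arg_cong[where f="measure (N n)"])
  moreover have "cdf \<mu>' (- exp (- c)) = measure Q {x \<in> space Q. V x \<le> c}"
    unfolding \<mu>'_def cdf_def by (subst measure_distr) (auto intro!: arg_cong[where f="measure Q"])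
  ultimately show ?thesis by (auto simp: weak_conv_m_def weak_conv_def)
qed

subsection \<open>Gaussian linearization of quadratic forms\<close>

text \<open>The Hubbard-Stratonovich identity; \<open>sqrt 2\<close> cancels the factor 1/2 in the
  exponent of the standard normal characteristic function.\<close>

lemma gaussian_linearization:
  fixes c :: real
  shows "(CLINT g|std_normal_distribution. iexp (sqrt 2 * g * c)) = exp (- c\<^sup>2)"
proof -
  have "char std_normal_distribution (sqrt 2 * c) = complex_of_real (exp (- c\<^sup>2))"
    by (simp add: char_std_normal_distribution power_mult_distrib)
  then show ?thesis by (simp add: char_def ac_simps)
qed

text \<open>One square is traded for a Gaussian shift of the direction h. Fubini applies because the
  integrand has modulus at most 1.\<close>

lemma quad_exp_linearization:
  fixes X :: "'w \<Rightarrow> 'h::{real_inner,second_countable_topology}" and a :: "nat \<Rightarrow> 'h"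
  assumes N: "prob_space N" and X[measurable]: "X \<in> borel_measurable N"
  shows "(CLINT \<omega>|N. iexp (inner (X \<omega>) h) * exp (- (\<Sum>k<Suc K. (inner (a k) (X \<omega>))\<^sup>2))) =
    (CLINT g|std_normal_distribution. CLINT \<omega>|N.
       iexp (inner (X \<omega>) (h + (sqrt 2 * g) *\<^sub>R a K)) * exp (- (\<Sum>k<K. (inner (a k) (X \<omega>))\<^sup>2)))"
proof -
  interpret N: prob_space N by (rule N)
  interpret S: real_distribution std_normal_distribution by (rule real_dist_normal_dist)
  interpret P: pair_prob_space N std_normal_distribution ..
  let ?E = "\<lambda>\<omega>. complex_of_real (exp (- (\<Sum>k<K. (inner (a k) (X \<omega>))\<^sup>2)))"
  let ?F = "\<lambda>\<omega> g. iexp (inner (X \<omega>) (h + (sqrt 2 * g) *\<^sub>R a K)) * ?E \<omega>"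
  have int: "integrable (N \<Otimes>\<^sub>M std_normal_distribution) (\<lambda>(\<omega>, g). ?F \<omega> g)"
    by (rule P.integrable_const_bound[of _ 1]) (auto intro!: AE_I2 simp: split_beta norm_mult sum_nonneg)
  have "(CLINT \<omega>|N. iexp (inner (X \<omega>) h) * exp (- (\<Sum>k<Suc K. (inner (a k) (X \<omega>))\<^sup>2))) =
    (CLINT \<omega>|N. CLINT g|std_normal_distribution. ?F \<omega> g)"
  proof (rule Bochner_Integration.integral_cong[OF refl])
    fix \<omega>
    have "(CLINT g|std_normal_distribution. ?F \<omega> g) =
      (CLINT g|std_normal_distribution. (iexp (inner (X \<omega>) h) * ?E \<omega>) * iexp (sqrt 2 * g * inner (a K) (X \<omega>)))"
      by (rule Bochner_Integration.integral_cong[OF refl])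
         (simp add: inner_add_right exp_add distrib_left inner_commute ac_simps)
    also have "\<dots> = (iexp (inner (X \<omega>) h) * ?E \<omega>) * exp (- (inner (a K) (X \<omega>))\<^sup>2)"
      unfolding integral_mult_right_zero gaussian_linearization ..
    also have "\<dots> = iexp (inner (X \<omega>) h) * exp (- (\<Sum>k<Suc K. (inner (a k) (X \<omega>))\<^sup>2))"
      by (simp add: exp_add[symmetric] exp_of_real[symmetric] algebra_simps)
    finally show "iexp (inner (X \<omega>) h) * exp (- (\<Sum>k<Suc K. (inner (a k) (X \<omega>))\<^sup>2)) =
      (CLINT g|std_normal_distribution. ?F \<omega> g)" by simp
  qed
  also have "\<dots> = (CLINT g|std_normal_distribution. CLINT \<omega>|N. ?F \<omega> g)"
    by (rule P.Fubini_integral[OF int, symmetric])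
  finally show ?thesis .
qed

lemma quad_exp_tendsto:
  fixes X :: "nat \<Rightarrow> 'w \<Rightarrow> 'h::{real_inner,second_countable_topology}" and Y :: "'a \<Rightarrow> 'h" and a :: "nat \<Rightarrow> 'h"
  assumes N: "\<And>n. prob_space (N n)" and X: "\<And>n. X n \<in> borel_measurable (N n)"
    and Q: "prob_space Q" and Y: "Y \<in> borel_measurable Q"
    and char: "\<And>h. (\<lambda>n. CLINT \<omega>|N n. iexp (inner (X n \<omega>) h)) \<longlonglongrightarrow> (CLINT x|Q. iexp (inner (Y x) h))"
  shows "(\<lambda>n. \<integral>\<omega>. exp (- (\<Sum>k<K. (inner (a k) (X n \<omega>))\<^sup>2)) \<partial>N n) \<longlonglongrightarrow>
    (\<integral>x. exp (- (\<Sum>k<K. (inner (a k) (Y x))\<^sup>2)) \<partial>Q)"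
proof -
  note [measurable] = X Y
  \<comment> \<open>Generalizing over h is what makes the induction on K work: removing the last
    square moves h to \<open>h + (sqrt 2 * g) *\<^sub>R a K\<close>. Case 0 is the hypothesis on
    characteristic functions, and the limit passes under the integral over g because the inner
    integrals are bounded by 1. The claim itself is the case h = 0.\<close>
  have main: "(\<lambda>n. CLINT \<omega>|N n. iexp (inner (X n \<omega>) h) * exp (- (\<Sum>k<K. (inner (a k) (X n \<omega>))\<^sup>2))) \<longlonglongrightarrow>
    (CLINT x|Q. iexp (inner (Y x) h) * exp (- (\<Sum>k<K. (inner (a k) (Y x))\<^sup>2)))" for h
  proof (induction K arbitrary: h)
    case 0
    show ?case using char[of h] by simp
  next
    case (Suc K)
    interpret S: real_distribution std_normal_distribution by (rule real_dist_normal_dist)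
    have m: "(\<lambda>g. CLINT \<omega>|M. iexp (inner (Z \<omega>) (h + (sqrt 2 * g) *\<^sub>R a K)) * exp (- (\<Sum>k<K. (inner (a k) (Z \<omega>))\<^sup>2)))
       \<in> borel_measurable std_normal_distribution"
      if M: "prob_space M" and [measurable]: "Z \<in> borel_measurable M" for M :: "'b measure" and Z :: "'b \<Rightarrow> 'h"
    proof -
      interpret prob_space M by (rule M)
      show ?thesis by measurable
    qed
    have b: "norm (CLINT \<omega>|M. iexp (inner (Z \<omega>) h') * exp (- (\<Sum>k<K. (inner (a k) (Z \<omega>))\<^sup>2))) \<le> 1"
      if M: "prob_space M" and [measurable]: "Z \<in> borel_measurable M"
      for M :: "'b measure" and Z :: "'b \<Rightarrow> 'h" and h'
    proof -
      interpret prob_space M by (rule M)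
      let ?f = "\<lambda>\<omega>. iexp (inner (Z \<omega>) h') * exp (- (\<Sum>k<K. (inner (a k) (Z \<omega>))\<^sup>2))"
      have 1: "norm (?f \<omega>) \<le> 1" for \<omega> by (simp add: norm_mult sum_nonneg)
      have "integrable M ?f" by (rule integrable_const_bound[of _ 1]) (use 1 in auto)
      then have "norm (CLINT \<omega>|M. ?f \<omega>) \<le> (\<integral>\<omega>. 1 \<partial>M)"
        by (intro integral_norm_bound[THEN order_trans] integral_mono) (use 1 in auto)
      then show ?thesis by (simp add: prob_space)
    qed
    show ?case
      unfolding quad_exp_linearization[OF N X] quad_exp_linearization[OF Q Y]
      by (rule integral_dominated_convergence[where w="\<lambda>_. 1"])
         (use m[OF N X] m[OF Q Y] Suc.IH b[OF N X] in auto)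
  qed
  have re: "(CLINT \<omega>|M. iexp (inner (Z \<omega>) 0) * exp (- (\<Sum>k<K. (inner (a k) (Z \<omega>))\<^sup>2))) =
     complex_of_real (\<integral>\<omega>. exp (- (\<Sum>k<K. (inner (a k) (Z \<omega>))\<^sup>2)) \<partial>M)" for M :: "'b measure" and Z :: "'b \<Rightarrow> 'h"
    by simp
  show ?thesis using main[of 0] unfolding re by (simp only: tendsto_of_real_iff)
qed

text \<open>Equal moments of exp(-W) and exp(-V) give equal means of every continuous function of
  them; tents shrinking to the point exp(-c) then isolate the atom at c.\<close>

lemma Laplace_imp_atom_eq:
  fixes W :: "'w \<Rightarrow> real" and V :: "'a \<Rightarrow> real"
  assumes N: "prob_space N" and W: "W \<in> borel_measurable N" "\<And>\<omega>. W \<omega> \<ge> 0"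
    and Q: "prob_space Q" and V: "V \<in> borel_measurable Q" "\<And>x. V x \<ge> 0"
    and eq: "\<And>t::nat. (\<integral>\<omega>. exp (- (real t * W \<omega>)) \<partial>N) = (\<integral>x. exp (- (real t * V x)) \<partial>Q)"
  shows "measure N {\<omega> \<in> space N. W \<omega> = c} = measure Q {x \<in> space Q. V x = c}"
proof -
  \<comment> \<open>Tent of height 1 and half-width 1/j around exp(-c); for j = 0 it is the constant
    1, which does not affect the limit.\<close>
  define f :: "nat \<Rightarrow> real \<Rightarrow> real" where "f j u = max 0 (1 - real j * \<bar>u - exp (- c)\<bar>)" for j u
  have fc: "continuous_on UNIV (f j)" for j
    unfolding f_def[abs_def] by (intro continuous_intros)
  have pw: "exp (- (real t * x)) = exp (- x) ^ t" for t and x :: real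
    by (simp add: exp_of_nat_mult[symmetric])
  \<comment> \<open>The limit theorem is applied to a sequence that is constant in n, where
    convergence means equality.\<close>
  have "(\<lambda>n::nat. \<integral>\<omega>. f j (exp (- W \<omega>)) \<partial>N) \<longlonglongrightarrow> (\<integral>x. f j (exp (- V x)) \<partial>Q)" for j
    by (rule moments_imp_integral_tendsto[OF N _ _ Q _ _ _ fc])
       (use W V eq in \<open>auto simp: pw\<close>)
  then have e: "(\<integral>\<omega>. f j (exp (- W \<omega>)) \<partial>N) = (\<integral>x. f j (exp (- V x)) \<partial>Q)" for j
    by (simp add: LIMSEQ_const_iff)
  have lim: "(\<lambda>j. \<integral>\<omega>. f j (exp (- X \<omega>)) \<partial>M) \<longlonglongrightarrow> measure M {\<omega> \<in> space M. X \<omega> = c}"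
    if M: "prob_space M" and [measurable]: "X \<in> borel_measurable M" for M :: "'b measure" and X
  proof -
    interpret prob_space M by (rule M)
    have [measurable]: "f j \<in> borel_measurable borel" for j
      using fc by (rule borel_measurable_continuous_onI)
    have p: "(\<lambda>j. f j (exp (- X \<omega>))) \<longlonglongrightarrow> indicator {\<omega> \<in> space M. X \<omega> = c} \<omega>"
      if "\<omega> \<in> space M" for \<omega>
    proof (cases "X \<omega> = c")
      case True then show ?thesis using that by (simp add: f_def)
    next
      case False
      let ?d = "\<bar>exp (- X \<omega>) - exp (- c)\<bar>"
      have "?d > 0" using False by simp
      then have "\<forall>\<^sub>F j in sequentially. 1 < real j * ?d"
        by (intro filterlim_at_top_dense[THEN iffD1, rule_format]
            filterlim_at_top_mult_tendsto_pos[OF tendsto_const _ filterlim_real_sequentially, where c = ?d, simplified mult.commute])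
      then have "\<forall>\<^sub>F j in sequentially. f j (exp (- X \<omega>)) = 0"
        by eventually_elim (simp add: f_def)
      then show ?thesis using False by (simp add: tendsto_eventually)
    qed
    have "(\<lambda>j. \<integral>\<omega>. f j (exp (- X \<omega>)) \<partial>M) \<longlonglongrightarrow> (\<integral>\<omega>. indicator {\<omega> \<in> space M. X \<omega> = c} \<omega> \<partial>M)"
      by (rule integral_dominated_convergence[where w="\<lambda>_. 1"])
         (use p in \<open>auto simp: f_def\<close>)
    then show ?thesis by (simp add: Int_absorb1 subset_eq)
  qed
  show ?thesis
    using LIMSEQ_unique[OF lim[OF N W(1), unfolded e] lim[OF Q V(1)]] .
qed

lemma quad_Laplace_approx:
  fixes a :: "nat \<Rightarrow> 'h::{real_inner,second_countable_topology}"
  assumes N: "prob_space N" and X[measurable]: "X \<in> borel_measurable N"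
    and sums: "\<And>x. (\<lambda>k. (inner (a k) x)\<^sup>2) sums W x" and t: "t \<ge> 0"
  shows "(\<lambda>K. \<integral>\<omega>. exp (- (t * (\<Sum>k<K. (inner (a k) (X \<omega>))\<^sup>2))) \<partial>N) \<longlonglongrightarrow>
    (\<integral>\<omega>. exp (- (t * W (X \<omega>))) \<partial>N)"
proof -
  interpret prob_space N by (rule N)
  have "W = (\<lambda>x. \<Sum>k. (inner (a k) x)\<^sup>2)" using sums by (auto simp: sums_iff)
  then have [measurable]: "W \<in> borel_measurable borel" by simp
  show ?thesis
  proof (rule integral_dominated_convergence[where w="\<lambda>_. 1"])
    show "AE \<omega> in N. (\<lambda>K. exp (- (t * (\<Sum>k<K. (inner (a k) (X \<omega>))\<^sup>2)))) \<longlonglongrightarrow> exp (- (t * W (X \<omega>)))"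
      by (intro AE_I2 tendsto_intros sums[unfolded sums_def])
    show "AE \<omega> in N. norm (exp (- (t * (\<Sum>k<K. (inner (a k) (X \<omega>))\<^sup>2)))) \<le> 1" for K
      using t by (auto intro!: AE_I2 mult_nonneg_nonneg sum_nonneg)
  qed auto
qed

lemma char_eq_imp_quad_Laplace_eq:
  fixes X :: "'w \<Rightarrow> 'h::{real_inner,second_countable_topology}" and Y :: "'a \<Rightarrow> 'h" and a :: "nat \<Rightarrow> 'h"
  assumes N: "prob_space N" and X: "X \<in> borel_measurable N"
    and Q: "prob_space Q" and Y: "Y \<in> borel_measurable Q"
    and char: "\<And>h. (CLINT \<omega>|N. iexp (inner (X \<omega>) h)) = (CLINT x|Q. iexp (inner (Y x) h))"
    and sums: "\<And>x. (\<lambda>k. (inner (a k) x)\<^sup>2) sums W x" and t: "t \<ge> 0"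
  shows "(\<integral>\<omega>. exp (- (t * W (X \<omega>))) \<partial>N) = (\<integral>x. exp (- (t * W (Y x))) \<partial>Q)"
proof -
  have "(\<integral>\<omega>. exp (- (t * (\<Sum>k<K. (inner (a k) (X \<omega>))\<^sup>2))) \<partial>N) =
    (\<integral>x. exp (- (t * (\<Sum>k<K. (inner (a k) (Y x))\<^sup>2))) \<partial>Q)" for K
    \<comment> \<open>The scale t is absorbed into the functionals through \<open>sqrt t\<close>;
      the sequence is again constant in n.\<close>
    using quad_exp_tendsto[where N="\<lambda>_. N" and X="\<lambda>_. X" and Q=Q and Y=Y and K=K and a="\<lambda>k. sqrt t *\<^sub>R a k"] assms
    by (simp add: LIMSEQ_const_iff power_mult_distrib sum_distrib_left)
  then show ?thesis
    using quad_Laplace_approx[OF N X sums t] quad_Laplace_approx[OF Q Y sums t] LIMSEQ_unique by simp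
qed

subsection \<open>Quadratic forms of Gaussian variables have no atoms\<close>

lemma quadratic_roots_bound:
  fixes u b w :: real
  assumes "\<not> (u = 0 \<and> w = 0)"
  shows "card {r::nat. r < n \<and> u + 2 * real r * b + (real r)\<^sup>2 * w = 0} \<le> 2"
proof -
  define p where "p = [:u, 2 * b, w:]"
  have p: "p \<noteq> 0" using assms by (auto simp: p_def)
  have "card {r::nat. r < n \<and> u + 2 * real r * b + (real r)\<^sup>2 * w = 0} =
     card (real ` {r::nat. r < n \<and> u + 2 * real r * b + (real r)\<^sup>2 * w = 0})"
    by (rule card_image[symmetric]) simp
  also have "\<dots> \<le> card {x. poly p x = 0}"
    by (rule card_mono[OF poly_roots_finite[OF p]]) (auto simp: p_def power2_eq_square algebra_simps)
  also have "\<dots> \<le> degree p" by (rule card_poly_roots_bound[OF p])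
  also have "\<dots> \<le> 2" by (simp add: p_def)
  finally show ?thesis .
qed

text \<open>If \<open>G'\<close> is an independent copy of \<open>G\<close>, then every rotation
  \<open>(G + r G') / sqrt (1 + r\<^sup>2)\<close> has the law of \<open>G\<close>, and the quadratic form takes the value \<open>c\<close> at it
  iff \<open>r\<close> is a root of a polynomial of degree at most two.  Unless the form is \<open>c\<close> at both \<open>G\<close> and
  \<open>G'\<close>, at most two of \<open>n\<close> values of \<open>r\<close> are roots; averaging over \<open>r\<close> bounds the atom by its square.\<close>
lemma gaussian_quad_atom_le_square:
  fixes G :: "'a \<Rightarrow> 'h::{real_inner,second_countable_topology}" and c :: real
  assumes Q: "prob_space Q" and G[measurable]: "G \<in> borel_measurable Q"
    and char: "\<And>h. (CLINT x|Q. iexp (inner (G x) h)) = complex_of_real (exp (- v h / 2))"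
    and v: "\<And>r h. v (r *\<^sub>R h) = r\<^sup>2 * v h"
    and T: "psd_op T" and bT: "bounded_linear T"
  defines "p \<equiv> measure Q {x \<in> space Q. inner (T (G x)) (G x) = c}"
  shows "p \<le> p\<^sup>2"
proof -
  interpret Q: prob_space Q by (rule Q)
  interpret P: pair_prob_space Q Q ..
  let ?R = "Q \<Otimes>\<^sub>M Q"
  have [measurable]: "T \<in> borel_measurable borel"
    by (intro borel_measurable_continuous_onI linear_continuous_on bT)
  obtain a where sums: "\<And>x. (\<lambda>k. (inner (a k) x)\<^sup>2) sums inner (T x) x"
    using quad_form_sums[OF T bT] by blast
  \<comment> \<open>Normalizes the coefficients 1 and r to squares that add up to 1, so the rotated
    pair keeps the variance \<open>v h\<close> in every direction.\<close>
  define s where "s r = sqrt (1 + (real r)\<^sup>2)" for r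
  have s: "s r > 0" "(s r)\<^sup>2 = 1 + (real r)\<^sup>2" for r by (auto simp: s_def add_pos_nonneg)
  define H where "H r z = (1 / s r) *\<^sub>R (G (fst z) + real r *\<^sub>R G (snd z))" for r z
  have Hm[measurable]: "H r \<in> borel_measurable ?R" for r unfolding H_def[abs_def] by measurable
  have charH: "(CLINT z|?R. iexp (inner (H r z) h)) = complex_of_real (exp (- v h / 2))" for r h
  proof -
    let ?f = "\<lambda>x. iexp (inner (G x) ((1 / s r) *\<^sub>R h))"
    let ?g = "\<lambda>x. iexp (inner (G x) ((real r / s r) *\<^sub>R h))"
    have "(CLINT z|?R. iexp (inner (H r z) h)) = (CLINT z|?R. ?f (fst z) * ?g (snd z))"
      by (rule Bochner_Integration.integral_cong[OF refl])
         (simp add: H_def inner_add_left exp_add[symmetric] field_simps)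
    also have "\<dots> = (CLINT x|Q. CLINT y|Q. ?f x * ?g y)"
    proof -
      have "integrable ?R (\<lambda>z. ?f (fst z) * ?g (snd z))"
        by (rule P.integrable_const_bound[of _ 1]) (auto simp: norm_mult)
      from P.integral_fst'[OF this] show ?thesis by simp
    qed
    also have "\<dots> = (CLINT x|Q. ?f x) * (CLINT x|Q. ?g x)"
      by simp
    also have "\<dots> = complex_of_real (exp (- v ((1 / s r) *\<^sub>R h) / 2 + - v ((real r / s r) *\<^sub>R h) / 2))"
      unfolding char exp_add by simp
    also have "- v ((1 / s r) *\<^sub>R h) / 2 + - v ((real r / s r) *\<^sub>R h) / 2 = - v h / 2"
    proof -
      have "v ((1 / s r) *\<^sub>R h) + v ((real r / s r) *\<^sub>R h) = ((1 + (real r)\<^sup>2) / (s r)\<^sup>2) * v h"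
        unfolding v power_divide by (simp add: add_divide_distrib algebra_simps)
      then have "v ((1 / s r) *\<^sub>R h) + v ((real r / s r) *\<^sub>R h) = v h" using s[of r] by (metis div_self less_irrefl mult_1 zero_less_power)
      then show ?thesis by simp
    qed
    finally show ?thesis .
  qed
  \<comment> \<open>Equal characteristic functions give equal Laplace transforms of the quadratic
    forms, and these give equal atoms.\<close>
  have law: "measure ?R {z \<in> space ?R. inner (T (H r z)) (H r z) = c} = p" for r
    unfolding p_def
    by (rule Laplace_imp_atom_eq[OF P.prob_space_axioms _ _ Q])
       (use psd_op_nonneg[OF T] char_eq_imp_quad_Laplace_eq[OF P.prob_space_axioms Hm Q G _ sums] charH char
        in auto)
  let ?W = "\<lambda>x. inner (T (G x)) (G x)"
  let ?B = "\<lambda>z. inner (T (G (fst z))) (G (snd z))"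
  \<comment> \<open>After clearing the denominator 1 + r^2 this is a polynomial equation in r. Its
    constant and leading coefficients vanish together exactly on the event that both copies take the
    value c.\<close>
  have quad: "inner (T (H r z)) (H r z) = c \<longleftrightarrow>
      (?W (fst z) - c) + 2 * real r * ?B z + (real r)\<^sup>2 * (?W (snd z) - c) = 0" for r z
  proof -
    have "inner (T (H r z)) (H r z) = (1 / (s r)\<^sup>2) * (?W (fst z) + 2 * (real r * ?B z) + (real r)\<^sup>2 * ?W (snd z))"
      unfolding H_def psd_op_scale[OF T]
      by (simp add: psd_op_quad_add[OF T] psd_op_scale[OF T] power2_eq_square)
    then have "inner (T (H r z)) (H r z) = c \<longleftrightarrow>
      ?W (fst z) + 2 * (real r * ?B z) + (real r)\<^sup>2 * ?W (snd z) = c * (s r)\<^sup>2"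
      using s(1)[of r] by (simp add: divide_eq_eq)
    then show ?thesis unfolding s(2) by (simp add: algebra_simps)
  qed
  define Z where "Z = {z \<in> space ?R. ?W (fst z) = c \<and> ?W (snd z) = c}"
  have Zm[measurable]: "Z \<in> sets ?R" unfolding Z_def by measurable
  define E where "E r = {z \<in> space ?R. inner (T (H r z)) (H r z) = c}" for r
  have Em[measurable]: "E r \<in> sets ?R" for r unfolding E_def by measurable
  have Zp: "measure ?R Z = p\<^sup>2"
  proof -
    let ?A = "{x \<in> space Q. ?W x = c}"
    have "Z = ?A \<times> ?A" by (auto simp: Z_def space_pair_measure)
    moreover have "measure ?R (?A \<times> ?A) = measure Q ?A * measure Q ?A"
      by (simp add: measure_def Q.emeasure_pair_measure_Times enn2real_mult)
    ultimately show ?thesis by (simp add: p_def power2_eq_square)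
  qed
  \<comment> \<open>The term 2 is the maximal number of roots off \<open>Z\<close>. It does not grow
    with n, so p > p^2 would fail for large n.\<close>
  have count: "real n * p \<le> real n * p\<^sup>2 + 2" for n
  proof -
    have pt: "(\<Sum>r<n. indicator (E r) z) \<le> real n * indicator Z z + 2" if z: "z \<in> space ?R" for z
    proof (cases "z \<in> Z")
      case True
      have "(\<Sum>r<n. indicator (E r) z) \<le> (\<Sum>r<n. (1::real))" by (intro sum_mono) (simp add: indicator_def)
      with True show ?thesis by simp
    next
      case False
      have "(\<Sum>r<n. indicator (E r) z) = real (card ({..<n} \<inter> {r. z \<in> E r}))"
        by (simp add: indicator_def of_bool_def sum.If_cases)
      also have "{..<n} \<inter> {r. z \<in> E r} = {r. r < n \<and> (?W (fst z) - c) + 2 * real r * ?B z + (real r)\<^sup>2 * (?W (snd z) - c) = 0}"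
        using z by (auto simp: E_def quad)
      also have "real (card \<dots>) \<le> 2"
        using quadratic_roots_bound[of "?W (fst z) - c" "?W (snd z) - c" n "?B z"] False z
        by (simp add: Z_def)
      finally show ?thesis using False by simp
    qed
    have "real n * p = (\<integral>z. (\<Sum>r<n. indicator (E r) z) \<partial>?R)"
      using law by (simp add: E_def[symmetric] P.emeasure_eq_measure)
    also have "\<dots> \<le> (\<integral>z. real n * indicator Z z + 2 \<partial>?R)"
      by (rule integral_mono) (use pt in \<open>auto simp: P.emeasure_eq_measure\<close>)
    also have "\<dots> = real n * p\<^sup>2 + 2"
      using Zp by (simp add: P.emeasure_eq_measure P.prob_space)
    finally show ?thesis .
  qed
  show ?thesis
  proof (rule ccontr)
    assume "\<not> p \<le> p\<^sup>2"
    then obtain n :: nat where "real n * (p - p\<^sup>2) > 2"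
      using reals_Archimedean3[of "p - p\<^sup>2"] by auto
    with count[of n] show False by (simp add: algebra_simps)
  qed
qed

text \<open>A nondegenerate normal variable has no almost sure upper bound: its density is positive
  everywhere and each half-line contains an interval of length one.\<close>

lemma normal_density_tail_pos:
  assumes "\<sigma> > 0"
  shows "emeasure (density lborel (normal_density \<mu> \<sigma>)) {B<..} \<noteq> 0"
proof
  assume "emeasure (density lborel (normal_density \<mu> \<sigma>)) {B<..} = 0"
  then have "(\<integral>\<^sup>+x. ennreal (normal_density \<mu> \<sigma> x) * indicator {B<..} x \<partial>lborel) = 0"
    by (simp add: emeasure_density)
  then have "AE x in lborel. ennreal (normal_density \<mu> \<sigma> x) * indicator {B<..} x = 0"
    by (subst (asm) nn_integral_0_iff_AE) auto
  moreover have "normal_density \<mu> \<sigma> x > 0" for x by (rule normal_density_pos[OF assms])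
  ultimately have "AE x in lborel. x \<notin> {B<..}"
    by (auto elim!: eventually_mono simp: indicator_def ennreal_eq_0_iff not_le[symmetric] split: if_splits)
  then have "emeasure lborel {B<..} = 0"
    by (subst (asm) AE_iff_measurable[of "{B<..}"]) auto
  moreover have "emeasure lborel {B<..B+1} \<le> emeasure lborel {B<..}" by (rule emeasure_mono) auto
  ultimately show False by simp
qed

lemma gaussian_quad_no_atom:
  fixes G :: "'a \<Rightarrow> 'h::{real_inner,second_countable_topology}"
  assumes Q: "prob_space Q" and G[measurable]: "G \<in> borel_measurable Q"
    and char: "\<And>h. (CLINT x|Q. iexp (inner (G x) h)) = complex_of_real (exp (- v h / 2))"
    and v: "\<And>r h. v (r *\<^sub>R h) = r\<^sup>2 * v h"
    and T: "psd_op T" and bT: "bounded_linear T"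
    and nondeg: "distr Q borel (\<lambda>x. inner (G x) (T h)) = density lborel (normal_density 0 \<sigma>)" "\<sigma> > 0"
  shows "measure Q {x \<in> space Q. inner (T (G x)) (G x) = c} = 0"
proof -
  interpret Q: prob_space Q by (rule Q)
  let ?W = "\<lambda>x. inner (T (G x)) (G x)"
  let ?p = "measure Q {x \<in> space Q. ?W x = c}"
  have [measurable]: "T \<in> borel_measurable borel"
    by (intro borel_measurable_continuous_onI linear_continuous_on bT)
  have "?p \<noteq> 1"
  proof
    assume "?p = 1"
    then have ae: "AE x in Q. ?W x = c" by (subst (asm) Q.prob_Collect_eq_1) auto
    \<comment> \<open>If the form equals c at G, Cauchy-Schwarz for the form bounds <T h, G> by this
      constant.\<close>
    define B where "B = sqrt (inner (T h) h * c)"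
    have "AE x in Q. inner (G x) (T h) \<notin> {B<..}"
      using ae
    proof eventually_elim
      case (elim x)
      have "(inner (T h) (G x))\<^sup>2 \<le> inner (T h) h * c"
        using psd_op_Cauchy_Schwarz[OF T, of h "G x"] elim by simp
      then have "inner (G x) (T h) \<le> B"
        unfolding B_def by (metis inner_commute real_le_rsqrt)
      then show ?case by simp
    qed
    then have "emeasure (distr Q borel (\<lambda>x. inner (G x) (T h))) {B<..} = 0"
      by (subst emeasure_distr) (auto simp: AE_iff_measurable[OF _ refl] vimage_def Int_def conj_commute)
    then show False using normal_density_tail_pos[OF nondeg(2)] by (simp add: nondeg(1))
  qed
  moreover have "?p \<le> ?p\<^sup>2" by (rule gaussian_quad_atom_le_square[OF Q G char v T bT])
  then have "?p * (1 - ?p) \<le> 0" by (simp add: algebra_simps power2_eq_square)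
  moreover have "0 \<le> ?p" "?p \<le> 1" by auto
  ultimately show ?thesis unfolding mult_le_0_iff by argo
qed

subsection \<open>Central limit theorem for quadratic forms\<close>

lemma indep_vars_PiM_coordinates:
  assumes P: "prob_space P" and I: "I \<noteq> {}"
  shows "prob_space.indep_vars (PiM I (\<lambda>_. P)) (\<lambda>_. P) (\<lambda>i \<omega>. \<omega> i) I"
proof -
  interpret R: prob_space "PiM I (\<lambda>_. P)" by (rule prob_space_PiM[OF P])
  have "distr (PiM I (\<lambda>_. P)) (PiM I (\<lambda>_. P)) (\<lambda>x. \<lambda>i\<in>I. x i) = distr (PiM I (\<lambda>_. P)) (PiM I (\<lambda>_. P)) (\<lambda>x. x)"
    by (rule distr_cong) (auto simp: space_PiM PiE_restrict)
  then have "distr (PiM I (\<lambda>_. P)) (PiM I (\<lambda>_. P)) (\<lambda>x. \<lambda>i\<in>I. x i) = PiM I (\<lambda>_. P)"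
    by simp
  also have "\<dots> = (\<Pi>\<^sub>M i\<in>I. distr (PiM I (\<lambda>_. P)) P (\<lambda>\<omega>. \<omega> i))"
    by (rule PiM_cong) (auto simp: distr_PiM_component[OF P])
  finally show ?thesis
    by (subst R.indep_vars_iff_distr_eq_PiM'[OF I]) auto
qed

lemma integral_PiM_component:
  fixes f :: "'z \<Rightarrow> 'b::{banach,second_countable_topology}"
  assumes P: "prob_space P" and i: "i \<in> I" and f: "f \<in> borel_measurable P"
  shows "(\<integral>\<omega>. f (\<omega> i) \<partial>PiM I (\<lambda>_. P)) = (\<integral>z. f z \<partial>P)"
    and "integrable (PiM I (\<lambda>_. P)) (\<lambda>\<omega>. f (\<omega> i)) \<longleftrightarrow> integrable P f"
proof -
  have d: "distr (PiM I (\<lambda>_. P)) P (\<lambda>\<omega>. \<omega> i) = P" by (rule distr_PiM_component[OF P i])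
  have m: "(\<lambda>\<omega>. \<omega> i) \<in> measurable (PiM I (\<lambda>_. P)) P" using i by measurable
  show "(\<integral>\<omega>. f (\<omega> i) \<partial>PiM I (\<lambda>_. P)) = (\<integral>z. f z \<partial>P)"
    using integral_distr[OF m f] d by simp
  show "integrable (PiM I (\<lambda>_. P)) (\<lambda>\<omega>. f (\<omega> i)) \<longleftrightarrow> integrable P f"
    using integrable_distr_eq[OF m f] d by simp
qed

lemma clt_char:
  fixes X :: "'z \<Rightarrow> real"
  assumes P: "prob_space P" and X[measurable]: "X \<in> borel_measurable P"
    and X2: "integrable P (\<lambda>z. (X z)\<^sup>2)" and X0: "(\<integral>z. X z \<partial>P) = 0"
  shows "(\<lambda>n. CLINT \<omega>|PiM {..<n} (\<lambda>_::nat. P). iexp ((\<Sum>i<n. X (\<omega> i)) / sqrt n))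
    \<longlonglongrightarrow> complex_of_real (exp (- (\<integral>z. (X z)\<^sup>2 \<partial>P) / 2))"
proof -
  interpret P: prob_space P by (rule P)
  define v where "v = (\<integral>z. (X z)\<^sup>2 \<partial>P)"
  have "v \<ge> 0" by (simp add: v_def)
  show ?thesis
  \<comment> \<open>The central limit theorem needs positive variance. For v = 0 the summands vanish
    almost surely and both sides are 1.\<close>
  proof (cases "v = 0")
    case True
    then have ae: "AE z in P. X z = 0"
      using integral_nonneg_eq_0_iff_AE[OF X2] by (simp add: v_def)
    have "(CLINT \<omega>|PiM {..<n} (\<lambda>_::nat. P). iexp ((\<Sum>i<n. X (\<omega> i)) / sqrt n)) = 1" for n :: nat
    proof -
      interpret R: prob_space "PiM {..<n} (\<lambda>_. P)" by (rule prob_space_PiM[OF P])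
      have "AE \<omega> in PiM {..<n} (\<lambda>_. P). \<forall>i\<in>{..<n}. X (\<omega> i) = 0"
        by (intro AE_ball_countable' AE_PiM_component[OF P _ ae]) (auto intro: countable_finite)
      then have "AE \<omega> in PiM {..<n} (\<lambda>_::nat. P). iexp ((\<Sum>i<n. X (\<omega> i)) / sqrt n) = 1"
        by eventually_elim simp
      then have "(CLINT \<omega>|PiM {..<n} (\<lambda>_::nat. P). iexp ((\<Sum>i<n. X (\<omega> i)) / sqrt n)) = (CLINT \<omega>|PiM {..<n} (\<lambda>_. P). 1)"
        by (intro integral_cong_AE) auto
      then show ?thesis by (simp add: R.prob_space)
    qed
    then show ?thesis using True by (simp add: v_def)
  next
    case False
    then have v: "v > 0" using \<open>v \<ge> 0\<close> by simp
    \<comment> \<open>The theorem needs one infinite sequence on one space, so the argument takes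
      place in the infinite product; restriction to the first n coordinates then recovers the finite
      one.\<close>
    let ?R = "PiM UNIV (\<lambda>_::nat. P)"
    interpret R: prob_space ?R by (rule prob_space_PiM[OF P])
    interpret PP: product_prob_space "\<lambda>_::nat. P" UNIV ..
    have ind: "R.indep_vars (\<lambda>_. borel) (\<lambda>i \<omega>. X (\<omega> i)) UNIV"
      by (rule R.indep_vars_compose2[OF indep_vars_PiM_coordinates[OF P]]) auto
    have Xi: "integrable P X" by (rule P.square_integrable_imp_integrable[OF X X2])
    have "weak_conv_m (\<lambda>n. distr ?R borel (\<lambda>\<omega>. (\<Sum>i<n. X (\<omega> i)) / sqrt (n * (sqrt v)\<^sup>2))) std_normal_distribution"
    proof (rule R.central_limit_theorem_zero_mean[OF ind, where \<mu>="distr P borel X"])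
      show "R.expectation (\<lambda>\<omega>. X (\<omega> n)) = 0" for n
        by (simp add: integral_PiM_component[OF P _ X] X0)
      show "0 < sqrt v" using v by simp
      show "integrable ?R (\<lambda>\<omega>. (X (\<omega> n))\<^sup>2)" for n
        using integral_PiM_component(2)[OF P, of n UNIV "\<lambda>z. (X z)\<^sup>2"] X2 by simp
      show "R.variance (\<lambda>\<omega>. X (\<omega> n)) = (sqrt v)\<^sup>2" for n
        using integral_PiM_component(1)[OF P, of n UNIV "\<lambda>z. (X z)\<^sup>2"] v
        by (simp add: integral_PiM_component[OF P _ X] X0 v_def[symmetric])
      show "distr ?R borel (\<lambda>\<omega>. X (\<omega> n)) = distr P borel X" for n
        using distr_distr[of X P borel "\<lambda>\<omega>. \<omega> n" ?R] distr_PiM_component[OF P, of n UNIV]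
        by (simp add: comp_def)
    qed
    \<comment> \<open>Evaluating at \<open>sqrt v\<close> undoes the division by the standard
      deviation.\<close>
    then have "(\<lambda>n. char (distr ?R borel (\<lambda>\<omega>. (\<Sum>i<n. X (\<omega> i)) / sqrt (n * (sqrt v)\<^sup>2))) (sqrt v))
        \<longlonglongrightarrow> char std_normal_distribution (sqrt v)"
      by (intro levy_continuity1 R.real_distribution_distr real_dist_normal_dist) auto
    moreover have "char (distr ?R borel (\<lambda>\<omega>. (\<Sum>i<n. X (\<omega> i)) / sqrt (n * (sqrt v)\<^sup>2))) (sqrt v) =
      (CLINT \<omega>|PiM {..<n} (\<lambda>_::nat. P). iexp ((\<Sum>i<n. X (\<omega> i)) / sqrt n))" for n
    proof -
      have "(CLINT \<omega>|PiM {..<n} (\<lambda>_::nat. P). iexp ((\<Sum>i<n. X (\<omega> i)) / sqrt n)) =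
        (CLINT \<omega>|distr ?R (PiM {..<n} (\<lambda>_. P)) (\<lambda>x. restrict x {..<n}). iexp ((\<Sum>i<n. X (\<omega> i)) / sqrt n))"
        by (subst PP.distr_PiM_restrict_finite) auto
      also have "\<dots> = (CLINT \<omega>|?R. iexp ((\<Sum>i<n. X (\<omega> i)) / sqrt n))"
        by (subst integral_distr) (auto intro!: measurable_restrict)
      finally show ?thesis
        using v by (simp add: char_def integral_distr real_sqrt_mult)
    qed
    ultimately show ?thesis
      using v by (simp add: char_std_normal_distribution v_def[symmetric])
  qed
qed

lemma integral_square_sum_iid:
  fixes X :: "'z \<Rightarrow> real"
  assumes P: "prob_space P" and X[measurable]: "X \<in> borel_measurable P"
    and X2: "integrable P (\<lambda>z. (X z)\<^sup>2)" and X0: "(\<integral>z. X z \<partial>P) = 0"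
  shows "(\<integral>\<omega>. (\<Sum>i<n. X (\<omega> i))\<^sup>2 \<partial>PiM {..<n} (\<lambda>_. P)) = real n * (\<integral>z. (X z)\<^sup>2 \<partial>P)"
    and "integrable (PiM {..<n} (\<lambda>_. P)) (\<lambda>\<omega>. (\<Sum>i<n. X (\<omega> i))\<^sup>2)"
proof -
  interpret P: prob_space P by (rule P)
  interpret PP: product_sigma_finite "\<lambda>_::nat. P" ..
  let ?R = "PiM {..<n} (\<lambda>_. P)"
  have Xi: "integrable P X" by (rule P.square_integrable_imp_integrable[OF X X2])
  have c: "integrable ?R (\<lambda>\<omega>. X (\<omega> i) * X (\<omega> j)) \<and>
      (\<integral>\<omega>. X (\<omega> i) * X (\<omega> j) \<partial>?R) = (if i = j then \<integral>z. (X z)\<^sup>2 \<partial>P else 0)"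
    if i: "i < n" and j: "j < n" for i j
  proof (cases "i = j")
    case True
    then show ?thesis
      using integral_PiM_component[OF P, of i "{..<n}" "\<lambda>z. (X z)\<^sup>2"] X2 i
      by (simp add: power2_eq_square)
  next
    case False
    \<comment> \<open>With factor X at positions i and j and 1 elsewhere, the mixed moment becomes a
      product integral, and the mean-zero factor at i makes it vanish.\<close>
    define f where "f k = (if k = i \<or> k = j then X else (\<lambda>_. 1))" for k
    have fi: "integrable P (f k)" for k using Xi by (simp add: f_def)
    have p: "(\<Prod>k<n. f k (\<omega> k)) = X (\<omega> i) * X (\<omega> j)" for \<omega>
    proof -
      have "(\<Prod>k<n. f k (\<omega> k)) = (\<Prod>k\<in>{i, j}. f k (\<omega> k))"
        by (rule prod.mono_neutral_right) (use i j in \<open>auto simp: f_def\<close>)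
      then show ?thesis using False by (simp add: f_def)
    qed
    have "(\<Prod>k<n. integral\<^sup>L P (f k)) = 0"
      by (rule prod_zero) (use i X0 in \<open>auto simp: f_def intro!: bexI[of _ i]\<close>)
    then show ?thesis
      using PP.product_integral_prod[of "{..<n}" f] PP.product_integrable_prod[of "{..<n}" f] fi False
      unfolding p by simp
  qed
  have e: "(\<Sum>i<n. X (\<omega> i))\<^sup>2 = (\<Sum>i<n. \<Sum>j<n. X (\<omega> i) * X (\<omega> j))" for \<omega>
    by (simp add: power2_eq_square sum_product)
  show "integrable ?R (\<lambda>\<omega>. (\<Sum>i<n. X (\<omega> i))\<^sup>2)"
    unfolding e using c by (intro Bochner_Integration.integrable_sum) auto
  have "(\<integral>\<omega>. (\<Sum>i<n. X (\<omega> i))\<^sup>2 \<partial>?R) = (\<Sum>i<n. \<Sum>j<n. \<integral>\<omega>. X (\<omega> i) * X (\<omega> j) \<partial>?R)"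
    unfolding e using c by (subst Bochner_Integration.integral_sum; (intro Bochner_Integration.integrable_sum)?; simp)+
  also have "\<dots> = (\<Sum>i<n. \<Sum>j<n. if i = j then \<integral>z. (X z)\<^sup>2 \<partial>P else 0)"
    using c by (intro sum.cong) auto
  also have "\<dots> = real n * (\<integral>z. (X z)\<^sup>2 \<partial>P)" by simp
  finally show "(\<integral>\<omega>. (\<Sum>i<n. X (\<omega> i))\<^sup>2 \<partial>?R) = real n * (\<integral>z. (X z)\<^sup>2 \<partial>P)" .
qed

section \<open>Second moments and Laplace transforms of normalized sums\<close>

definition scaled_sum :: "('z \<Rightarrow> 'h::real_vector) \<Rightarrow> nat \<Rightarrow> (nat \<Rightarrow> 'z) \<Rightarrow> 'h" where
  "scaled_sum \<phi> n \<omega> = (1 / sqrt (real n)) *\<^sub>R (\<Sum>i<n. \<phi> (\<omega> i))"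

lemma borel_measurable_scaled_sum:
  fixes \<phi> :: "'z \<Rightarrow> 'h::{real_normed_vector,second_countable_topology}"
  assumes [measurable]: "\<phi> \<in> borel_measurable P"
  shows "scaled_sum \<phi> n \<in> borel_measurable (PiM {..<n} (\<lambda>_. P))"
  unfolding scaled_sum_def[abs_def] by measurable

lemma integrable_inner_square:
  fixes \<phi> :: "'z \<Rightarrow> 'h::{real_inner,second_countable_topology}"
  assumes [measurable]: "\<phi> \<in> borel_measurable P" and i: "integrable P (\<lambda>z. (norm (\<phi> z))\<^sup>2)"
  shows "integrable P (\<lambda>z. (inner h (\<phi> z))\<^sup>2)"
proof (rule Bochner_Integration.integrable_bound)
  show "integrable P (\<lambda>z. (norm h)\<^sup>2 * (norm (\<phi> z))\<^sup>2)" using i by simp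
  have "(inner h (\<phi> z))\<^sup>2 \<le> (norm h)\<^sup>2 * (norm (\<phi> z))\<^sup>2" for z
    using Cauchy_Schwarz_ineq[of h "\<phi> z"] by (simp add: power2_norm_eq_inner)
  then show "AE z in P. norm ((inner h (\<phi> z))\<^sup>2) \<le> norm ((norm h)\<^sup>2 * (norm (\<phi> z))\<^sup>2)" by simp
qed simp

text \<open>Independent centred summands keep the expected value of a quadratic form, because a
  form that is a sum of squares of functionals reduces this to real variances.\<close>
lemma nn_integral_quad_scaled_sum:
  fixes \<phi> :: "'z \<Rightarrow> 'h::{real_inner,banach,second_countable_topology}"
  assumes P: "prob_space P" and \<phi>[measurable]: "\<phi> \<in> borel_measurable P"
    and \<phi>2: "integrable P (\<lambda>z. (norm (\<phi> z))\<^sup>2)" and \<phi>0: "(\<integral>z. \<phi> z \<partial>P) = 0"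
    and sums: "\<And>x. (\<lambda>k. (inner (a k) x)\<^sup>2) sums W x" and n: "n > 0"
  shows "(\<integral>\<^sup>+\<omega>. ennreal (W (scaled_sum \<phi> n \<omega>)) \<partial>PiM {..<n} (\<lambda>_. P)) = (\<integral>\<^sup>+z. ennreal (W (\<phi> z)) \<partial>P)"
proof -
  interpret P: prob_space P by (rule P)
  let ?R = "PiM {..<n} (\<lambda>_. P)"
  have [measurable]: "scaled_sum \<phi> n \<in> borel_measurable ?R" by (rule borel_measurable_scaled_sum[OF \<phi>])
  have W: "ennreal (W x) = (\<Sum>k. ennreal ((inner (a k) x)\<^sup>2))" for x
    using sums[of x] by (subst suminf_ennreal2) (auto simp: sums_iff)
  have "integrable P (\<lambda>z. norm (\<phi> z))"
    by (rule P.square_integrable_imp_integrable[OF _ \<phi>2]) simp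
  then have \<phi>i: "integrable P \<phi>" by (simp add: integrable_norm_iff)
  have comp: "(\<integral>\<^sup>+\<omega>. ennreal ((inner h (scaled_sum \<phi> n \<omega>))\<^sup>2) \<partial>?R) = (\<integral>\<^sup>+z. ennreal ((inner h (\<phi> z))\<^sup>2) \<partial>P)" for h
  proof -
    have 2: "integrable P (\<lambda>z. (inner h (\<phi> z))\<^sup>2)" by (rule integrable_inner_square[OF \<phi> \<phi>2])
    have 0: "(\<integral>z. inner h (\<phi> z) \<partial>P) = 0" using \<phi>i \<phi>0 by simp
    have e: "(inner h (scaled_sum \<phi> n \<omega>))\<^sup>2 = (1 / real n) * (\<Sum>i<n. inner h (\<phi> (\<omega> i)))\<^sup>2" for \<omega>
      using n by (simp add: scaled_sum_def power_divide power_mult_distrib inner_sum_right)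
    note m = integral_square_sum_iid[OF P _ 2 0, of n]
    have "(\<integral>\<^sup>+\<omega>. ennreal ((inner h (scaled_sum \<phi> n \<omega>))\<^sup>2) \<partial>?R) = ennreal (\<integral>\<omega>. (inner h (scaled_sum \<phi> n \<omega>))\<^sup>2 \<partial>?R)"
      by (rule nn_integral_eq_integral) (use m(2) in \<open>auto simp: e\<close>)
    also have "(\<integral>\<omega>. (inner h (scaled_sum \<phi> n \<omega>))\<^sup>2 \<partial>?R) = (\<integral>z. (inner h (\<phi> z))\<^sup>2 \<partial>P)"
      using m(1) n by (simp add: e)
    also have "ennreal \<dots> = (\<integral>\<^sup>+z. ennreal ((inner h (\<phi> z))\<^sup>2) \<partial>P)"
      by (rule nn_integral_eq_integral[symmetric]) (use 2 in auto)
    finally show ?thesis .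
  qed
  \<comment> \<open>Nonnegative integrals allow the exchange with the infinite sum without any prior
    integrability of W at the sum.\<close>
  have "(\<integral>\<^sup>+\<omega>. ennreal (W (scaled_sum \<phi> n \<omega>)) \<partial>?R) = (\<Sum>k. \<integral>\<^sup>+\<omega>. ennreal ((inner (a k) (scaled_sum \<phi> n \<omega>))\<^sup>2) \<partial>?R)"
    unfolding W by (rule nn_integral_suminf) measurable
  also have "\<dots> = (\<integral>\<^sup>+z. ennreal (W (\<phi> z)) \<partial>P)"
    unfolding comp W by (rule nn_integral_suminf[symmetric]) measurable
  finally show ?thesis .
qed

lemma abs_diff_exp_minus_le:
  fixes u w :: real
  assumes "0 \<le> u" "u \<le> w"
  shows "\<bar>exp (- w) - exp (- u)\<bar> \<le> w - u"
proof -
  have "exp (- u) - exp (- w) = exp (- u) * (1 - exp (- (w - u)))"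
    by (simp add: algebra_simps exp_add[symmetric])
  also have "\<dots> \<le> 1 * (w - u)"
    using assms exp_ge_add_one_self[of "u - w"] by (intro mult_mono) (auto simp del: exp_ge_add_one_self)
  finally show ?thesis using assms by simp
qed

text \<open>An interchange of limits in n and in the number K of squares. For fixed K the truncated
  transforms converge in n, and truncation is harmless in the limit law; the truncation error before
  the limit is at most t times the mean tail \<open>\<delta> K\<close>, the same for all n >
  0.\<close>

lemma clt_quad_Laplace:
  fixes \<phi> :: "'z \<Rightarrow> 'h::{real_inner,banach,second_countable_topology}" and G :: "'a \<Rightarrow> 'h"
  assumes P: "prob_space P" and \<phi>[measurable]: "\<phi> \<in> borel_measurable P"
    and \<phi>2: "integrable P (\<lambda>z. (norm (\<phi> z))\<^sup>2)" and \<phi>0: "(\<integral>z. \<phi> z \<partial>P) = 0"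
    and sums: "\<And>x. (\<lambda>k. (inner (a k) x)\<^sup>2) sums W x" and W\<phi>: "integrable P (\<lambda>z. W (\<phi> z))"
    and Q: "prob_space Q" and G[measurable]: "G \<in> borel_measurable Q"
    and char: "\<And>h. (CLINT x|Q. iexp (inner (G x) h)) = complex_of_real (exp (- (\<integral>z. (inner (\<phi> z) h)\<^sup>2 \<partial>P) / 2))"
    and t: "t \<ge> 0"
  shows "(\<lambda>n. \<integral>\<omega>. exp (- (t * W (scaled_sum \<phi> n \<omega>))) \<partial>PiM {..<n} (\<lambda>_. P)) \<longlonglongrightarrow>
    (\<integral>x. exp (- (t * W (G x))) \<partial>Q)"
proof -
  interpret P: prob_space P by (rule P)
  let ?R = "\<lambda>n. PiM {..<n} (\<lambda>_. P)"
  let ?S = "scaled_sum \<phi>"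
  define V where "V K x = (\<Sum>k<K. (inner (a k) x)\<^sup>2)" for K x
  have R: "prob_space (?R n)" for n by (rule prob_space_PiM[OF P])
  have Sm[measurable]: "?S n \<in> borel_measurable (?R n)" for n by (rule borel_measurable_scaled_sum[OF \<phi>])
  have Weq: "W = (\<lambda>x. \<Sum>k. (inner (a k) x)\<^sup>2)" using sums by (auto simp: sums_iff)
  then have Wm[measurable]: "W \<in> borel_measurable borel" by simp
  have Vm[measurable]: "V K \<in> borel_measurable borel" for K unfolding V_def[abs_def] by measurable
  have VW: "0 \<le> V K x" "V K x \<le> W x" for K x
    using sum_le_suminf[OF sums_summable[OF sums[of x]], of "{..<K}"]
    by (auto simp: V_def Weq intro: sum_nonneg)
  have "integrable P (\<lambda>z. norm (\<phi> z))"
    by (rule P.square_integrable_imp_integrable[OF _ \<phi>2]) simp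
  then have \<phi>i: "integrable P \<phi>" by (simp add: integrable_norm_iff)
  have charS: "(\<lambda>n. CLINT \<omega>|?R n. iexp (inner (?S n \<omega>) h)) \<longlonglongrightarrow> (CLINT x|Q. iexp (inner (G x) h))" for h
  proof -
    have 2: "integrable P (\<lambda>z. (inner (\<phi> z) h)\<^sup>2)"
      using integrable_inner_square[OF \<phi> \<phi>2, of h] by (simp add: inner_commute)
    have 0: "(\<integral>z. inner (\<phi> z) h \<partial>P) = 0" using \<phi>i \<phi>0 by simp
    have "inner (?S n \<omega>) h = (\<Sum>i<n. inner (\<phi> (\<omega> i)) h) / sqrt n" for n \<omega>
      by (simp add: scaled_sum_def inner_sum_left)
    then show ?thesis using clt_char[OF P _ 2 0] by (simp add: char)
  qed
  define A where "A n = (\<integral>\<omega>. exp (- (t * W (?S n \<omega>))) \<partial>?R n)" for n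
  define A' where "A' K n = (\<integral>\<omega>. exp (- (t * V K (?S n \<omega>))) \<partial>?R n)" for K n
  define B where "B = (\<integral>x. exp (- (t * W (G x))) \<partial>Q)"
  define B' where "B' K = (\<integral>x. exp (- (t * V K (G x))) \<partial>Q)" for K
  define \<delta> where "\<delta> K = (\<integral>z. W (\<phi> z) - V K (\<phi> z) \<partial>P)" for K
  have AB: "A' K \<longlonglongrightarrow> B' K" for K
    using quad_exp_tendsto[where N="?R" and X="?S" and Q=Q and Y=G and K=K and a="\<lambda>k. sqrt t *\<^sub>R a k",
      OF R Sm Q G charS] t
    by (simp add: A'_def[abs_def] B'_def V_def power_mult_distrib sum_distrib_left)
  have BB: "B' \<longlonglongrightarrow> B"
    using quad_Laplace_approx[OF Q G sums t] by (simp add: B'_def[abs_def] B_def V_def)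
  have iV: "integrable P (\<lambda>z. V K (\<phi> z))" for K
    by (rule Bochner_Integration.integrable_bound[OF W\<phi>]) (use VW(1) order_trans[OF VW(2) abs_ge_self] in \<open>auto intro!: AE_I2\<close>)
  have \<delta>0: "\<delta> \<longlonglongrightarrow> 0"
  proof -
    have "(\<lambda>K. \<integral>z. W (\<phi> z) - V K (\<phi> z) \<partial>P) \<longlonglongrightarrow> (\<integral>z. 0 \<partial>P)"
    proof (rule integral_dominated_convergence[OF _ _ W\<phi>])
      have "(\<lambda>K. W x - V K x) \<longlonglongrightarrow> W x - W x" for x
        unfolding V_def by (intro tendsto_intros sums[unfolded sums_def])
      then show "AE z in P. (\<lambda>K. W (\<phi> z) - V K (\<phi> z)) \<longlonglongrightarrow> 0" by simp
      show "AE z in P. norm (W (\<phi> z) - V K (\<phi> z)) \<le> W (\<phi> z)" for K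
        using VW by (auto intro!: AE_I2)
    qed auto
    then show ?thesis by (simp add: \<delta>_def[abs_def])
  qed
  \<comment> \<open>The tail \<open>W - V K\<close> is the sum of squares of the shifted functionals
    \<open>a (k + K)\<close>, so its mean at the normalized sum equals its mean at a single \<phi>,
    whatever n is. That exp(-u) is 1-Lipschitz for u >= 0 turns this into a bound on the
    transforms.\<close>
  have unif: "\<bar>A n - A' K n\<bar> \<le> t * \<delta> K" if n: "n > 0" for n K
  proof -
    interpret R: prob_space "?R n" by (rule R)
    have tail: "(\<lambda>k. (inner (a (k + K)) x)\<^sup>2) sums (W x - V K x)" for x
      unfolding V_def by (rule sums_split_initial_segment[OF sums])
    have nn: "(\<integral>\<^sup>+\<omega>. ennreal (W (?S n \<omega>) - V K (?S n \<omega>)) \<partial>?R n) = ennreal (\<delta> K)"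
      unfolding nn_integral_quad_scaled_sum[where W="\<lambda>x. W x - V K x" and a="\<lambda>k. a (k + K)", OF P \<phi> \<phi>2 \<phi>0 tail n] \<delta>_def
      by (rule nn_integral_eq_integral) (use W\<phi> iV VW in auto)
    have \<delta>n: "\<delta> K \<ge> 0" unfolding \<delta>_def using VW by simp
    have int: "integrable (?R n) (\<lambda>\<omega>. W (?S n \<omega>) - V K (?S n \<omega>))"
      by (rule integrableI_nonneg) (use nn VW in auto)
    have val: "(\<integral>\<omega>. W (?S n \<omega>) - V K (?S n \<omega>) \<partial>?R n) = \<delta> K"
      by (rule integral_eq_nn_integral[THEN trans]) (use nn VW \<delta>n in auto)
    have b: "\<bar>exp (- (t * W (?S n \<omega>))) - exp (- (t * V K (?S n \<omega>)))\<bar> \<le> t * (W (?S n \<omega>) - V K (?S n \<omega>))" for \<omega>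
      using abs_diff_exp_minus_le[of "t * V K (?S n \<omega>)" "t * W (?S n \<omega>)"] VW[of K "?S n \<omega>"] t
      by (simp add: mult_left_mono right_diff_distrib)
    have i1: "integrable (?R n) (\<lambda>\<omega>. exp (- (t * W (?S n \<omega>))))"
      by (rule R.integrable_const_bound[of _ 1]) (use t order_trans[OF VW] in \<open>auto intro!: AE_I2 mult_nonneg_nonneg\<close>)
    have i2: "integrable (?R n) (\<lambda>\<omega>. exp (- (t * V K (?S n \<omega>))))"
      by (rule R.integrable_const_bound[of _ 1]) (use t VW in \<open>auto intro!: AE_I2 mult_nonneg_nonneg\<close>)
    have "\<bar>A n - A' K n\<bar> = \<bar>\<integral>\<omega>. exp (- (t * W (?S n \<omega>))) - exp (- (t * V K (?S n \<omega>))) \<partial>?R n\<bar>"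
      unfolding A_def A'_def using i1 i2 by simp
    also have "\<dots> \<le> (\<integral>\<omega>. t * (W (?S n \<omega>) - V K (?S n \<omega>)) \<partial>?R n)"
      by (rule integral_abs_bound[THEN order_trans], rule integral_mono) (use i1 i2 int b in auto)
    also have "\<dots> = t * \<delta> K" using val by simp
    finally show ?thesis .
  qed
  have "A \<longlonglongrightarrow> B"
  proof (rule LIMSEQ_I)
    fix r :: real assume r: "r > 0"
    have "(\<lambda>K. t * \<delta> K) \<longlonglongrightarrow> t * 0" by (intro tendsto_intros \<delta>0)
    then have "\<forall>\<^sub>F K in sequentially. t * \<delta> K < r / 3"
      using r by (intro order_tendstoD) auto
    moreover have "\<forall>\<^sub>F K in sequentially. dist (B' K) B < r / 3"
      using BB r by (intro tendstoD) auto
    ultimately obtain K where K: "t * \<delta> K < r / 3" "\<bar>B' K - B\<bar> < r / 3"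
      using eventually_happens[OF eventually_conj] by (force simp: dist_real_def)
    have "\<forall>\<^sub>F n in sequentially. dist (A' K n) (B' K) < r / 3"
      using AB r by (intro tendstoD) auto
    then have "\<forall>\<^sub>F n in sequentially. norm (A n - B) < r"
      using eventually_gt_at_top[of 0]
    proof eventually_elim
      case (elim n)
      then show ?case using K unif[of n K] unfolding dist_real_def real_norm_def by linarith
    qed
    then show "\<exists>no. \<forall>n\<ge>no. norm (A n - B) < r" by (simp add: eventually_sequentially)
  qed
  then show ?thesis by (simp add: A_def[abs_def] B_def)
qed

section \<open>Characteristic function and nondegeneracy of the Gaussian limit\<close>

lemma iexp_expectation_normal:
  fixes X :: "'a \<Rightarrow> real"
  assumes X[measurable]: "X \<in> borel_measurable Q" and v: "v \<ge> 0"
    and d: "distr Q borel X = (if v = 0 then return borel 0 else density lborel (normal_density 0 (sqrt v)))"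
  shows "(CLINT x|Q. iexp (X x)) = complex_of_real (exp (- v / 2))"
proof -
  have e: "(CLINT x|Q. iexp (X x)) = (CLINT x|distr Q borel X. iexp x)"
    by (subst integral_distr) auto
  show ?thesis
  proof (cases "v = 0")
    case True
    then show ?thesis unfolding e d by (simp add: integral_return)
  next
    case False
    let ?D = "density lborel (normal_density 0 (sqrt v))"
    have s: "sqrt v > 0" using False v by simp
    interpret D: prob_space ?D by (rule prob_space_normal_density[OF s])
    have "distr ?D lborel (\<lambda>x. x) = ?D" by (rule distr_id2) simp
    then have "distributed ?D lborel (\<lambda>x. x) (normal_density 0 (sqrt v))"
      by (simp add: distributed_def)
    then have "distributed ?D lborel (\<lambda>x. (x - 0) / sqrt v) std_normal_density"
      by (rule D.normal_standard_normal_convert[OF s, THEN iffD1])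
    then have std: "distr ?D lborel (\<lambda>x. x / sqrt v) = std_normal_distribution"
      by (simp add: distributed_def)
    have "complex_of_real (exp (- v / 2)) = char std_normal_distribution (sqrt v)"
      using v by (simp add: char_std_normal_distribution)
    also have "\<dots> = (CLINT x|distr ?D lborel (\<lambda>x. x / sqrt v). iexp (sqrt v * x))"
      unfolding std char_def ..
    also have "\<dots> = (CLINT x|?D. iexp (sqrt v * (x / sqrt v)))"
      by (subst integral_distr) auto
    also have "\<dots> = (CLINT x|?D. iexp x)" using s by simp
    finally show ?thesis unfolding e d using False by simp
  qed
qed

lemma tight_gaussian_char:
  fixes G :: "'a \<Rightarrow> 'h::{real_inner,banach,second_countable_topology}"
  assumes "tight_gaussian Q G P \<phi>"
  shows "(CLINT x|Q. iexp (inner (G x) h)) = complex_of_real (exp (- (\<integral>z. (inner (\<phi> z) h)\<^sup>2 \<partial>P) / 2))"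
  by (rule iexp_expectation_normal) (use assms in \<open>auto simp: tight_gaussian_def Let_def\<close>)

text \<open>If the variance vanished in every direction in the range of \<Omega>, then by
  self-adjointness \<Omega> applied to \<phi> would be orthogonal to everything, hence zero almost
  everywhere, and positive definiteness would force \<phi> = 0.\<close>

lemma op_class_nondegenerate:
  fixes \<phi> :: "'z \<Rightarrow> 'h::{real_inner,banach,second_countable_topology}"
  assumes \<phi>[measurable]: "\<phi> \<in> borel_measurable P" and \<phi>2: "integrable P (\<lambda>z. (norm (\<phi> z))\<^sup>2)"
    and \<Omega>: "\<Omega> \<in> op_class" and pos: "(\<integral>z. (norm (\<phi> z))\<^sup>2 \<partial>P) > 0"
  shows "\<exists>h. (\<integral>z. (inner (\<phi> z) (blinfun_apply \<Omega> h))\<^sup>2 \<partial>P) > 0"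
proof (rule ccontr)
  assume c: "\<not> (\<exists>h. (\<integral>z. (inner (\<phi> z) (blinfun_apply \<Omega> h))\<^sup>2 \<partial>P) > 0)"
  have ae: "AE z in P. inner (blinfun_apply \<Omega> (\<phi> z)) h = 0" for h
  proof -
    have i: "integrable P (\<lambda>z. (inner (\<phi> z) (blinfun_apply \<Omega> h))\<^sup>2)"
      using integrable_inner_square[OF \<phi> \<phi>2, of "blinfun_apply \<Omega> h"] by (simp add: inner_commute)
    have "(\<integral>z. (inner (\<phi> z) (blinfun_apply \<Omega> h))\<^sup>2 \<partial>P) \<ge> 0" by simp
    then have "(\<integral>z. (inner (\<phi> z) (blinfun_apply \<Omega> h))\<^sup>2 \<partial>P) = 0" using c by (metis less_eq_real_def)
    then have "AE z in P. (inner (\<phi> z) (blinfun_apply \<Omega> h))\<^sup>2 = 0"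
      using integral_nonneg_eq_0_iff_AE[OF i] by simp
    then show ?thesis using \<Omega> by (simp add: op_class_def)
  qed
  obtain d :: "nat \<Rightarrow> 'h" where d: "\<And>x e. e > 0 \<Longrightarrow> \<exists>k. dist x (d k) < e"
    using ex_dense_sequence by metis
  \<comment> \<open>The exceptional null set depends on the direction; a dense sequence leaves a
    single null set.\<close>
  have "AE z in P. \<forall>k. inner (blinfun_apply \<Omega> (\<phi> z)) (d k) = 0"
    using ae by (simp add: AE_all_countable)
  then have "AE z in P. (norm (\<phi> z))\<^sup>2 = 0"
  proof eventually_elim
    case (elim z)
    let ?x = "blinfun_apply \<Omega> (\<phi> z)"
    have "norm ?x * norm ?x \<le> 0 + e" if "e > 0" for e
    proof -
      \<comment> \<open>The added 1 keeps the denominator positive when \<open>?x\<close> is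
        zero.\<close>
      obtain k where k: "dist ?x (d k) < e / (norm ?x + 1)"
        using d[of "e / (norm ?x + 1)" ?x] \<open>e > 0\<close> by (auto simp: add_nonneg_pos)
      have "norm ?x * norm ?x = inner ?x (?x - d k)"
        using elim by (simp add: inner_diff_right power2_norm_eq_inner[symmetric] power2_eq_square)
      also have "\<dots> \<le> norm ?x * norm (?x - d k)" by (rule norm_cauchy_schwarz)
      also have "\<dots> \<le> (norm ?x + 1) * (e / (norm ?x + 1))"
        using k by (intro mult_mono) (auto simp: dist_norm)
      also have "\<dots> = e" by (simp add: add_nonneg_eq_0_iff)
      finally show ?thesis by simp
    qed
    then have "norm ?x * norm ?x \<le> 0" by (rule field_le_epsilon)
    then have "?x = 0" by (simp add: mult_le_0_iff)
    then have "inner ?x (\<phi> z) = 0" by simp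
    then have "\<phi> z = 0" using \<Omega> by (metis (mono_tags, lifting) less_irrefl mem_Collect_eq op_class_def)
    then show ?case by simp
  qed
  then have "(\<integral>z. (norm (\<phi> z))\<^sup>2 \<partial>P) = (\<integral>z. 0 \<partial>P)"
    by (intro integral_cong_AE) auto
  with pos show False by simp
qed

lemma tight_gaussian_quad_no_atom:
  fixes G :: "'a \<Rightarrow> 'h::{real_inner,banach,second_countable_topology}"
  assumes \<phi>: "\<phi> \<in> L2H P" and \<Omega>: "\<Omega> \<in> op_class" and pos: "(\<integral>z. (norm (\<phi> z))\<^sup>2 \<partial>P) > 0"
    and G: "tight_gaussian Q G P \<phi>"
  shows "measure Q {x \<in> space Q. wq (G x) \<Omega> = c} = 0"
proof -
  have "\<phi> \<in> borel_measurable P" "integrable P (\<lambda>z. (norm (\<phi> z))\<^sup>2)" using \<phi> by (auto simp: L2H_def)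
  from op_class_nondegenerate[OF this \<Omega> pos]
  obtain h where h: "(\<integral>z. (inner (\<phi> z) (blinfun_apply \<Omega> h))\<^sup>2 \<partial>P) > 0" by blast
  have Q: "prob_space Q" and Gm: "G \<in> borel_measurable Q" using G by (auto simp: tight_gaussian_def)
  have d: "distr Q borel (\<lambda>x. inner (G x) (blinfun_apply \<Omega> h)) =
      density lborel (normal_density 0 (sqrt (\<integral>z. (inner (\<phi> z) (blinfun_apply \<Omega> h))\<^sup>2 \<partial>P)))"
    using G h by (simp add: tight_gaussian_def Let_def)
  show ?thesis
    unfolding wq_def
    by (rule gaussian_quad_no_atom[OF Q Gm tight_gaussian_char[OF G] _ psd_op_op_class[OF \<Omega>]
          blinfun.bounded_linear_right d])
       (use h in \<open>simp_all add: power_mult_distrib\<close>)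
qed

subsection \<open>Expansion of the cross-fitted estimator\<close>

lemma emp_diff: "emp A \<omega> (\<lambda>z. f z - g z) = emp A \<omega> f - emp A \<omega> g"
  by (simp add: emp_def sum_subtractf scaleR_diff_right)

text \<open>If \<open>phi j m \<omega>\<close> is not integrable then neither is \<open>phi j m \<omega> - \<phi>0\<close>, so that both Bochner
  integrals are zero by convention and the identity survives.\<close>
lemma crossfit_est_expansion:
  fixes \<phi>0 :: "'z \<Rightarrow> 'h::{banach,second_countable_topology}"
  assumes \<phi>0: "integrable P0 \<phi>0" "(\<integral>z. \<phi>0 z \<partial>P0) = 0" and m: "m > 0"
  shows "crossfit_est \<nu> Phat phi m \<omega> - \<nu> P0 =
    (1/2) *\<^sub>R (\<Sum>j\<in>{1,2}. remainder_term \<nu> P0 Phat phi j m \<omega> + drift_term P0 \<phi>0 phi j m \<omega>)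
    + (1 / real (2*m)) *\<^sub>R (\<Sum>i<2*m. \<phi>0 (\<omega> i))"
proof -
  have i: "(\<integral>z. phi j m \<omega> z - \<phi>0 z \<partial>P0) = (\<integral>z. phi j m \<omega> z \<partial>P0)" for j
  proof (cases "integrable P0 (phi j m \<omega>)")
    case True then show ?thesis using \<phi>0 by simp
  next
    case False
    have "\<not> integrable P0 (\<lambda>z. phi j m \<omega> z - \<phi>0 z)"
    proof
      assume "integrable P0 (\<lambda>z. phi j m \<omega> z - \<phi>0 z)"
      from Bochner_Integration.integrable_add[OF this \<phi>0(1)] False show False by simp
    qed
    with False show ?thesis by (simp add: not_integrable_integral_eq)
  qed
  have t: "\<nu> (Phat j m \<omega>) + emp (eval_idx j m) \<omega> (phi j m \<omega>) =
     remainder_term \<nu> P0 Phat phi j m \<omega> + drift_term P0 \<phi>0 phi j m \<omega> + \<nu> P0 + emp (eval_idx j m) \<omega> \<phi>0" for j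
    by (simp add: remainder_term_def drift_term_def emp_diff i)
  \<comment> \<open>The two evaluation folds partition the sample into halves of size m, so
    averaging the two fold means gives weight 1/(2m) to each observation.\<close>
  have "{..<2*m} = {m..<2*m} \<union> {..<m}" by auto
  then have "(\<Sum>i<2*m. \<phi>0 (\<omega> i)) = (\<Sum>i\<in>{m..<2*m} \<union> {..<m}. \<phi>0 (\<omega> i))" by (rule arg_cong)
  also have "\<dots> = (\<Sum>i\<in>{m..<2*m}. \<phi>0 (\<omega> i)) + (\<Sum>i<m. \<phi>0 (\<omega> i))"
    by (rule sum.union_disjoint) auto
  finally have e: "(1/2) *\<^sub>R (emp (eval_idx 1 m) \<omega> \<phi>0 + emp (eval_idx 2 m) \<omega> \<phi>0) = (1 / real (2*m)) *\<^sub>R (\<Sum>i<2*m. \<phi>0 (\<omega> i))"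
    using m by (simp add: emp_def eval_idx_def scaleR_add_right[symmetric])
  have half: "(1/2) *\<^sub>R (\<nu> P0 + \<nu> P0) = \<nu> P0" by (simp add: scaleR_2[symmetric])
  show ?thesis
    unfolding crossfit_est_def t
    using e half by (simp add: scaleR_add_right algebra_simps)
qed

text \<open>The error splits into the change of operator at S + E and the change of point under the
  fixed operator. Being pointwise, the bound applies to estimators that need not be
  measurable.\<close>

lemma wq_perturb:
  fixes S E :: "'h::real_inner"
  shows "\<bar>wq (S + E) \<Omega> - wq S \<Omega>0\<bar> \<le>
    norm (\<Omega> - \<Omega>0) * (norm S + norm E)\<^sup>2 + norm \<Omega>0 * (norm E * (2 * norm S + norm E))"
proof -
  have b: "\<bar>inner (blinfun_apply A x) y\<bar> \<le> norm A * (norm x * norm y)" for A :: "'h \<Rightarrow>\<^sub>L 'h" and x y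
    using Cauchy_Schwarz_ineq2[of "blinfun_apply A x" y] mult_right_mono[OF norm_blinfun[of A x] norm_ge_zero[of y]]
    by (simp add: mult.assoc)
  have "wq (S + E) \<Omega> - wq S \<Omega>0 = inner (blinfun_apply (\<Omega> - \<Omega>0) (S + E)) (S + E)
      + (inner (blinfun_apply \<Omega>0 S) E + inner (blinfun_apply \<Omega>0 E) S + inner (blinfun_apply \<Omega>0 E) E)"
    by (simp add: wq_def blinfun.diff_left blinfun.add_right inner_diff_left inner_add_left inner_add_right)
  also have "\<bar>\<dots>\<bar> \<le> norm (\<Omega> - \<Omega>0) * (norm (S + E) * norm (S + E)) + (norm \<Omega>0 * (norm S * norm E)
      + norm \<Omega>0 * (norm E * norm S) + norm \<Omega>0 * (norm E * norm E))"
    using b[of "\<Omega> - \<Omega>0" "S + E" "S + E"] b[of \<Omega>0 S E] b[of \<Omega>0 E S] b[of \<Omega>0 E E] by linarith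
  also have "\<dots> \<le> norm (\<Omega> - \<Omega>0) * ((norm S + norm E) * (norm S + norm E)) + (norm \<Omega>0 * (norm S * norm E)
      + norm \<Omega>0 * (norm E * norm S) + norm \<Omega>0 * (norm E * norm E))"
    by (intro add_mono mult_left_mono mult_mono norm_triangle_ineq) auto
  finally show ?thesis by (simp add: power2_eq_square algebra_simps)
qed

subsection \<open>Asymptotic coverage\<close>

text \<open>Outer probability tending to 0, phrased through measurable covers: the sets involve
  estimators and need not be measurable, while covers can be united and compared with ordinary
  measures.\<close>

definition negligible_seq :: "(nat \<Rightarrow> 'w measure) \<Rightarrow> (nat \<Rightarrow> 'w set) \<Rightarrow> bool" where
  "negligible_seq S A \<longleftrightarrow>
     (\<forall>\<kappa>>0. \<forall>\<^sub>F m in sequentially. \<exists>B\<in>sets (S m). A m \<inter> space (S m) \<subseteq> B \<and> measure (S m) B < \<kappa>)"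

lemma negligible_seq_union:
  assumes S: "\<And>m. prob_space (S m)" and A: "negligible_seq S A" and B: "negligible_seq S B"
  shows "negligible_seq S (\<lambda>m. A m \<union> B m)"
  unfolding negligible_seq_def
proof (intro allI impI)
  fix \<kappa> :: real assume "\<kappa> > 0"
  then have "\<forall>\<^sub>F m in sequentially. \<exists>C\<in>sets (S m). A m \<inter> space (S m) \<subseteq> C \<and> measure (S m) C < \<kappa> / 2"
    "\<forall>\<^sub>F m in sequentially. \<exists>C\<in>sets (S m). B m \<inter> space (S m) \<subseteq> C \<and> measure (S m) C < \<kappa> / 2"
    using A B unfolding negligible_seq_def by (meson half_gt_zero)+
  then show "\<forall>\<^sub>F m in sequentially. \<exists>C\<in>sets (S m). (A m \<union> B m) \<inter> space (S m) \<subseteq> C \<and> measure (S m) C < \<kappa>"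
  proof eventually_elim
    case (elim m)
    interpret prob_space "S m" by (rule S)
    obtain C D where C: "C \<in> sets (S m)" "A m \<inter> space (S m) \<subseteq> C" "measure (S m) C < \<kappa> / 2"
      and D: "D \<in> sets (S m)" "B m \<inter> space (S m) \<subseteq> D" "measure (S m) D < \<kappa> / 2" using elim by blast
    have "measure (S m) (C \<union> D) < \<kappa>" using measure_Un_le[OF C(1) D(1)] C(3) D(3) by linarith
    then show ?case using C D by (intro bexI[of _ "C \<union> D"]) auto
  qed
qed

lemma small_op_negligible_seq:
  assumes S: "\<And>m. prob_space (S m)" and X: "small_op S a X" and e: "e > 0"
  shows "negligible_seq S (\<lambda>m. {\<omega>. a m * norm (X m \<omega>) > e})"
  unfolding negligible_seq_def
proof (intro allI impI)
  fix \<kappa> :: real assume \<kappa>: "\<kappa> > 0"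
  have "(\<lambda>m. outer_measure_of (S m) {\<omega>\<in>space (S m). a m * norm (X m \<omega>) > e}) \<longlonglongrightarrow> 0"
    using X e by (simp add: small_op_def)
  then have "\<forall>\<^sub>F m in sequentially. outer_measure_of (S m) {\<omega>\<in>space (S m). a m * norm (X m \<omega>) > e} < ennreal \<kappa>"
    using \<kappa> by (intro order_tendstoD) auto
  then show "\<forall>\<^sub>F m in sequentially. \<exists>B\<in>sets (S m). {\<omega>. a m * norm (X m \<omega>) > e} \<inter> space (S m) \<subseteq> B \<and> measure (S m) B < \<kappa>"
  proof eventually_elim
    case (elim m)
    interpret prob_space "S m" by (rule S)
    obtain B where B: "B \<in> sets (S m)" "{\<omega>\<in>space (S m). a m * norm (X m \<omega>) > e} \<subseteq> B" "emeasure (S m) B < ennreal \<kappa>"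
      using elim by (auto simp: outer_measure_of_def INF_less_iff)
    then have "measure (S m) B < \<kappa>" using \<kappa> by (simp add: emeasure_eq_measure ennreal_less_iff)
    then show ?case using B by auto
  qed
qed

text \<open>Without atoms the distribution function is continuous, so the level set is closed and
  contains its infimum, which gives at least p; values to the left are below p, and left continuity
  gives at most p. The bounds on p make the set nonempty and bounded below.\<close>

lemma quantile_of_atomless:
  assumes Q: "prob_space Q" and V[measurable]: "V \<in> borel_measurable Q"
    and atom: "\<And>c. measure Q {x \<in> space Q. V x = c} = 0" and p: "0 < p" "p < 1"
  shows "isCont (\<lambda>c. measure Q {x \<in> space Q. V x \<le> c}) c"
    and "measure Q {x \<in> space Q. V x \<le> quantile_of Q V p} = p"
proof -
  define D where "D = distr Q borel V"
  interpret D: real_distribution D unfolding D_def by (rule prob_space.real_distribution_distr[OF Q V])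
  have F: "measure Q {x \<in> space Q. V x \<le> c} = cdf D c" for c
    unfolding D_def cdf_def by (subst measure_distr) (auto intro!: arg_cong[where f="measure Q"])
  have "measure D {c} = measure Q {x \<in> space Q. V x = c}" for c
    unfolding D_def by (subst measure_distr) (auto intro!: arg_cong[where f="measure Q"])
  then have cont: "isCont (cdf D) c" for c using atom by (simp add: D.isCont_cdf)
  then show "isCont (\<lambda>c. measure Q {x \<in> space Q. V x \<le> c}) c" by (simp add: F)
  let ?A = "{t. cdf D t \<ge> p}"
  have "\<forall>\<^sub>F t in at_top. p < cdf D t"
    using D.cdf_lim_at_top_prob p by (intro order_tendstoD) auto
  then obtain t1 where t1: "t1 \<in> ?A" by (auto simp: eventually_at_top_linorder intro: less_imp_le)
  have "\<forall>\<^sub>F t in at_bot. cdf D t < p"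
    using D.cdf_lim_at_bot p by (intro order_tendstoD) auto
  then obtain t0 where t0: "\<And>t. t \<le> t0 \<Longrightarrow> cdf D t < p" by (auto simp: eventually_at_bot_linorder)
  have bdd: "bdd_below ?A" by (rule bdd_belowI[of _ t0]) (metis linear mem_Collect_eq not_le t0)
  define q where "q = Inf ?A"
  have cl: "closed ?A"
    using cont by (intro closed_Collect_le continuous_intros continuous_at_imp_continuous_on) auto
  have "q \<in> ?A" unfolding q_def by (rule closed_contains_Inf[OF _ bdd cl]) (use t1 in auto)
  moreover have "cdf D q \<le> p"
  proof (rule tendsto_upperbound)
    show "(cdf D \<longlongrightarrow> cdf D q) (at_left q)" using cont[of q] by (auto simp: isCont_def filterlim_at_split)
    show "\<forall>\<^sub>F t in at_left q. cdf D t \<le> p"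
      unfolding eventually_at_left_field
    proof (intro exI[of _ "q - 1"] conjI allI impI)
      fix t assume "q - 1 < t" "t < q"
      then have "t \<notin> ?A" using cInf_lower[OF _ bdd, of t] by (auto simp: q_def)
      then show "cdf D t \<le> p" by simp
    qed simp
  qed simp
  ultimately have "cdf D q = p" by simp
  then show "measure Q {x \<in> space Q. V x \<le> quantile_of Q V p} = p"
    by (simp add: F q_def quantile_of_def)
qed

section \<open>Tightness of the normalized sums\<close>

lemma psd_op_ident: "psd_op (\<lambda>x. x)"
  by (auto simp: psd_op_def intro: linear_ident)

text \<open>Chebyshev with a second moment that does not depend on n. The squared norm is itself a
  sum of squares of functionals, namely the Cholesky expansion of the identity.\<close>

lemma scaled_sum_tight:
  fixes \<phi> :: "'z \<Rightarrow> 'h::{real_inner,banach,second_countable_topology}"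
  assumes P: "prob_space P" and \<phi>[measurable]: "\<phi> \<in> borel_measurable P"
    and \<phi>2: "integrable P (\<lambda>z. (norm (\<phi> z))\<^sup>2)" and \<phi>0: "(\<integral>z. \<phi> z \<partial>P) = 0" and \<kappa>: "\<kappa> > 0"
  shows "\<exists>B>0. \<forall>n>0. measure (PiM {..<n} (\<lambda>_. P)) {\<omega> \<in> space (PiM {..<n} (\<lambda>_. P)). norm (scaled_sum \<phi> n \<omega>) > B} < \<kappa>"
proof -
  obtain a where sums: "\<And>x::'h. (\<lambda>k. (inner (a k) x)\<^sup>2) sums inner x x"
    using quad_form_sums[OF psd_op_ident] bounded_linear_ident by blast
  define K where "K = (\<integral>z. (norm (\<phi> z))\<^sup>2 \<partial>P)"
  have K: "K \<ge> 0" by (simp add: K_def)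
  \<comment> \<open>\<open>K + 1\<close> in place of \<open>K\<close> keeps B positive when
    \<open>K = 0\<close> and makes the final inequality strict, since K / (K + 1) < 1.\<close>
  define B where "B = sqrt ((K + 1) / \<kappa>)"
  have B: "B > 0" "B\<^sup>2 = (K + 1) / \<kappa>" using K \<kappa> by (auto simp: B_def)
  have "measure (PiM {..<n} (\<lambda>_. P)) {\<omega> \<in> space (PiM {..<n} (\<lambda>_. P)). norm (scaled_sum \<phi> n \<omega>) > B} < \<kappa>"
    if n: "n > 0" for n
  proof -
    let ?R = "PiM {..<n} (\<lambda>_. P)" and ?S = "scaled_sum \<phi> n"
    interpret R: prob_space ?R by (rule prob_space_PiM[OF P])
    have [measurable]: "?S \<in> borel_measurable ?R" by (rule borel_measurable_scaled_sum[OF \<phi>])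
    have "(\<integral>\<^sup>+\<omega>. ennreal ((norm (?S \<omega>))\<^sup>2) \<partial>?R) = (\<integral>\<^sup>+z. ennreal ((norm (\<phi> z))\<^sup>2) \<partial>P)"
      using nn_integral_quad_scaled_sum[OF P \<phi> \<phi>2 \<phi>0 sums n] by (simp add: power2_norm_eq_inner)
    also have "\<dots> = ennreal K" unfolding K_def by (rule nn_integral_eq_integral) (use \<phi>2 in auto)
    finally have nn: "(\<integral>\<^sup>+\<omega>. ennreal ((norm (?S \<omega>))\<^sup>2) \<partial>?R) = ennreal K" .
    have int: "integrable ?R (\<lambda>\<omega>. (norm (?S \<omega>))\<^sup>2)"
      by (rule integrableI_nonneg) (use nn in auto)
    have val: "(\<integral>\<omega>. (norm (?S \<omega>))\<^sup>2 \<partial>?R) = K"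
      by (rule integral_eq_nn_integral[THEN trans]) (use nn K in auto)
    have "measure ?R {\<omega> \<in> space ?R. norm (?S \<omega>) > B} \<le> measure ?R {\<omega> \<in> space ?R. B\<^sup>2 \<le> (norm (?S \<omega>))\<^sup>2}"
      by (rule R.finite_measure_mono) (use B(1) in \<open>auto intro!: power_mono\<close>)
    also have "\<dots> \<le> (\<integral>\<omega>. (norm (?S \<omega>))\<^sup>2 \<partial>?R) / B\<^sup>2"
      by (rule integral_Markov_inequality_measure[OF int, where A="{}"]) (use B(1) in auto)
    also have "\<dots> = \<kappa> * (K / (K + 1))" using K unfolding val B(2) by simp
    also have "\<dots> < \<kappa> * 1" using K \<kappa> by (intro mult_strict_left_mono) auto
    finally show ?thesis by simp
  qed
  with B show ?thesis by blast
qed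

text \<open>Off the cover of large R and off the event that z is below \<zeta> - d, the bound W <=
  \<zeta> - 2 d implies coverage: one d absorbs R and the other absorbs the error of z.\<close>

lemma asymptotic_coverage_lower:
  fixes S :: "nat \<Rightarrow> 'w measure" and F :: "real \<Rightarrow> real"
  assumes S: "\<And>m. prob_space (S m)" and W: "\<And>m. W m \<in> borel_measurable (S m)"
    and z: "\<And>m. z m \<in> borel_measurable (S m)" and C: "\<And>m. C m \<in> sets (S m)"
    and rep: "\<forall>\<^sub>F m in sequentially. \<forall>\<omega>\<in>space (S m). W m \<omega> + R m \<omega> \<le> z m \<omega> \<longrightarrow> \<omega> \<in> C m"
    and neg: "\<And>e. e > 0 \<Longrightarrow> negligible_seq S (\<lambda>m. {\<omega>. \<bar>R m \<omega>\<bar> > e})"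
    and conv: "\<And>c. (\<lambda>m. measure (S m) {\<omega> \<in> space (S m). W m \<omega> \<le> c}) \<longlonglongrightarrow> F c"
    and cont: "isCont F \<zeta>"
    and zlim: "\<And>\<delta>. \<delta> > 0 \<Longrightarrow> (\<lambda>m. measure (S m) {\<omega> \<in> space (S m). z m \<omega> \<ge> \<zeta> - \<delta>}) \<longlonglongrightarrow> 1"
    and e: "e > 0"
  shows "\<forall>\<^sub>F m in sequentially. measure (S m) (C m) > F \<zeta> - e"
proof -
  obtain s where s: "s > 0" "\<And>x. \<bar>x - \<zeta>\<bar> < s \<Longrightarrow> \<bar>F x - F \<zeta>\<bar> < e / 4"
    using cont e unfolding continuous_at_eps_delta dist_real_def by (metis divide_pos_pos zero_less_numeral)
  \<comment> \<open>Makes 2 d smaller than s. The allowance e is spent in quarters: on continuity of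
    F, convergence of the laws, the cover of R, and the event for z.\<close>
  define d where "d = s / 4"
  have d: "d > 0" using s by (simp add: d_def)
  have "\<bar>F (\<zeta> - 2 * d) - F \<zeta>\<bar> < e / 4" by (rule s(2)) (use s(1) in \<open>simp add: d_def\<close>)
  then have Fd: "F (\<zeta> - 2 * d) > F \<zeta> - e / 4" by linarith
  have "\<forall>\<^sub>F m in sequentially. measure (S m) {\<omega> \<in> space (S m). W m \<omega> \<le> \<zeta> - 2 * d} > F (\<zeta> - 2 * d) - e / 4"
    using conv e by (intro order_tendstoD(1)) auto
  moreover have "\<forall>\<^sub>F m in sequentially. \<exists>B\<in>sets (S m). {\<omega>. \<bar>R m \<omega>\<bar> > d} \<inter> space (S m) \<subseteq> B \<and> measure (S m) B < e / 4"
    using neg[OF d, unfolded negligible_seq_def, rule_format, of "e / 4"] e by simp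
  moreover have "\<forall>\<^sub>F m in sequentially. measure (S m) {\<omega> \<in> space (S m). z m \<omega> \<ge> \<zeta> - d} > 1 - e / 4"
    using zlim[OF d] e by (intro order_tendstoD(1)) auto
  ultimately show ?thesis using rep
  proof eventually_elim
    case (elim m)
    interpret prob_space "S m" by (rule S)
    note [measurable] = W z C
    obtain B where B[measurable]: "B \<in> sets (S m)" and B': "{\<omega>. \<bar>R m \<omega>\<bar> > d} \<inter> space (S m) \<subseteq> B" "measure (S m) B < e / 4"
      using elim(2) by blast
    let ?Z = "{\<omega> \<in> space (S m). z m \<omega> \<ge> \<zeta> - d}"
    have Z: "?Z \<in> sets (S m)" by measurable
    have "measure (S m) {\<omega> \<in> space (S m). W m \<omega> \<le> \<zeta> - 2 * d} \<le> measure (S m) (C m \<union> (B \<union> (space (S m) - ?Z)))"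
    proof (rule finite_measure_mono)
      show "{\<omega> \<in> space (S m). W m \<omega> \<le> \<zeta> - 2 * d} \<subseteq> C m \<union> (B \<union> (space (S m) - ?Z))"
      proof
        fix \<omega> assume \<omega>: "\<omega> \<in> {\<omega> \<in> space (S m). W m \<omega> \<le> \<zeta> - 2 * d}"
        show "\<omega> \<in> C m \<union> (B \<union> (space (S m) - ?Z))"
        proof (rule ccontr)
          assume n: "\<omega> \<notin> C m \<union> (B \<union> (space (S m) - ?Z))"
          then have "\<bar>R m \<omega>\<bar> \<le> d" "z m \<omega> \<ge> \<zeta> - d" using \<omega> B' by (auto simp: subset_eq not_less)
          then have "W m \<omega> + R m \<omega> \<le> z m \<omega>" using \<omega> by auto
          then show False using elim(4) \<omega> n by auto
        qed
      qed
    qed measurable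
    also have "\<dots> \<le> measure (S m) (C m) + (measure (S m) B + measure (S m) (space (S m) - ?Z))"
      by (intro measure_Un_le[THEN order_trans] add_left_mono) (use C Z B in auto)
    also have "measure (S m) (space (S m) - ?Z) = 1 - measure (S m) ?Z" by (rule prob_compl[OF Z])
    finally show ?case using elim(1,3) B'(2) Fd by linarith
  qed
qed

text \<open>The mirror image, with a margin of 2 d above \<zeta>. It requires z not to exceed
  \<zeta> by much, which follows from convergence in probability but not from the one-sided
  condition of part (ii); hence part (ii) claims only a lower limit.\<close>

lemma asymptotic_coverage_upper:
  fixes S :: "nat \<Rightarrow> 'w measure" and F :: "real \<Rightarrow> real"
  assumes S: "\<And>m. prob_space (S m)" and W: "\<And>m. W m \<in> borel_measurable (S m)"
    and z: "\<And>m. z m \<in> borel_measurable (S m)" and C: "\<And>m. C m \<in> sets (S m)"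
    and rep: "\<forall>\<^sub>F m in sequentially. \<forall>\<omega>\<in>C m. W m \<omega> + R m \<omega> \<le> z m \<omega>"
    and neg: "\<And>e. e > 0 \<Longrightarrow> negligible_seq S (\<lambda>m. {\<omega>. \<bar>R m \<omega>\<bar> > e})"
    and conv: "\<And>c. (\<lambda>m. measure (S m) {\<omega> \<in> space (S m). W m \<omega> \<le> c}) \<longlonglongrightarrow> F c"
    and cont: "isCont F \<zeta>"
    and zlim: "\<And>\<delta>. \<delta> > 0 \<Longrightarrow> (\<lambda>m. measure (S m) {\<omega> \<in> space (S m). z m \<omega> \<le> \<zeta> + \<delta>}) \<longlonglongrightarrow> 1"
    and e: "e > 0"
  shows "\<forall>\<^sub>F m in sequentially. measure (S m) (C m) < F \<zeta> + e"
proof -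
  obtain s where s: "s > 0" "\<And>x. \<bar>x - \<zeta>\<bar> < s \<Longrightarrow> \<bar>F x - F \<zeta>\<bar> < e / 4"
    using cont e unfolding continuous_at_eps_delta dist_real_def by (metis divide_pos_pos zero_less_numeral)
  define d where "d = s / 4"
  have d: "d > 0" using s by (simp add: d_def)
  have "\<bar>F (\<zeta> + 2 * d) - F \<zeta>\<bar> < e / 4" by (rule s(2)) (use s(1) in \<open>simp add: d_def\<close>)
  then have Fd: "F (\<zeta> + 2 * d) < F \<zeta> + e / 4" by linarith
  have "\<forall>\<^sub>F m in sequentially. measure (S m) {\<omega> \<in> space (S m). W m \<omega> \<le> \<zeta> + 2 * d} < F (\<zeta> + 2 * d) + e / 4"
    using conv e by (intro order_tendstoD(2)) auto
  moreover have "\<forall>\<^sub>F m in sequentially. \<exists>B\<in>sets (S m). {\<omega>. \<bar>R m \<omega>\<bar> > d} \<inter> space (S m) \<subseteq> B \<and> measure (S m) B < e / 4"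
    using neg[OF d, unfolded negligible_seq_def, rule_format, of "e / 4"] e by simp
  moreover have "\<forall>\<^sub>F m in sequentially. measure (S m) {\<omega> \<in> space (S m). z m \<omega> \<le> \<zeta> + d} > 1 - e / 4"
    using zlim[OF d] e by (intro order_tendstoD(1)) auto
  ultimately show ?thesis using rep
  proof eventually_elim
    case (elim m)
    interpret prob_space "S m" by (rule S)
    note [measurable] = W z C
    obtain B where B[measurable]: "B \<in> sets (S m)" and B': "{\<omega>. \<bar>R m \<omega>\<bar> > d} \<inter> space (S m) \<subseteq> B" "measure (S m) B < e / 4"
      using elim(2) by blast
    let ?Z = "{\<omega> \<in> space (S m). z m \<omega> \<le> \<zeta> + d}" and ?A = "{\<omega> \<in> space (S m). W m \<omega> \<le> \<zeta> + 2 * d}"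
    have Z: "?Z \<in> sets (S m)" and A: "?A \<in> sets (S m)" by measurable
    have "measure (S m) (C m) \<le> measure (S m) (?A \<union> (B \<union> (space (S m) - ?Z)))"
    proof (rule finite_measure_mono)
      show "C m \<subseteq> ?A \<union> (B \<union> (space (S m) - ?Z))"
      proof
        fix \<omega> assume \<omega>: "\<omega> \<in> C m"
        then have sp: "\<omega> \<in> space (S m)" using sets.sets_into_space[OF C] by blast
        show "\<omega> \<in> ?A \<union> (B \<union> (space (S m) - ?Z))"
        proof (rule ccontr)
          assume n: "\<omega> \<notin> ?A \<union> (B \<union> (space (S m) - ?Z))"
          then have "\<bar>R m \<omega>\<bar> \<le> d" "z m \<omega> \<le> \<zeta> + d" "W m \<omega> > \<zeta> + 2 * d" using sp B' by (auto simp: subset_eq not_le not_less)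
          moreover have "W m \<omega> + R m \<omega> \<le> z m \<omega>" using elim(4) \<omega> by blast
          ultimately show False by linarith
        qed
      qed
    qed measurable
    also have "\<dots> \<le> measure (S m) ?A + (measure (S m) B + measure (S m) (space (S m) - ?Z))"
      by (intro measure_Un_le[THEN order_trans] add_left_mono) (use A Z B in auto)
    also have "measure (S m) (space (S m) - ?Z) = 1 - measure (S m) ?Z" by (rule prob_compl[OF Z])
    finally show ?case using elim(1,3) B'(2) Fd by linarith
  qed
qed

section \<open>Reduction of the scaled statistic to a quadratic form of the normalized sum\<close>

lemma wq_scaleR: "wq (c *\<^sub>R x) \<Omega> = c\<^sup>2 * wq x \<Omega>"
  by (simp add: wq_def blinfun.scaleR_right power2_eq_square)

text \<open>After multiplication by sqrt(2m) the estimation error is the normalized sum plus a small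
  vector. Tightness of the sum is what makes the perturbation bound small, because that bound grows
  with its norm.\<close>

lemma crossfit_quad_expansion_negligible:
  fixes \<phi>0 :: "'z \<Rightarrow> 'h::{real_inner,banach,second_countable_topology}"
    and Omega0 :: "'h \<Rightarrow>\<^sub>L 'h"
  assumes P: "prob_space P0" and \<phi>[measurable]: "\<phi>0 \<in> borel_measurable P0"
    and \<phi>2: "integrable P0 (\<lambda>z. (norm (\<phi>0 z))\<^sup>2)" and \<phi>m: "(\<integral>z. \<phi>0 z \<partial>P0) = 0"
    and rem: "\<And>j. j \<in> {1,2} \<Longrightarrow>
                small_op (sample P0) (\<lambda>m. sqrt (real (2*m))) (remainder_term \<nu> P0 Phat phi j)"
    and drift: "\<And>j. j \<in> {1,2} \<Longrightarrow>
                small_op (sample P0) (\<lambda>m. sqrt (real (2*m))) (drift_term P0 \<phi>0 phi j)"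
    and cons: "small_op (sample P0) (\<lambda>m. 1) (\<lambda>m \<omega>. Omega m \<omega> - Omega0)"
    and e: "e > 0"
  shows "negligible_seq (sample P0) (\<lambda>m. {\<omega>. \<bar>real (2*m) * wq (crossfit_est \<nu> Phat phi m \<omega> - \<nu> P0) (Omega m \<omega>)
      - wq (scaled_sum \<phi>0 (2*m) \<omega>) Omega0\<bar> > e})"
  unfolding negligible_seq_def
proof (intro allI impI)
  fix \<kappa> :: real assume \<kappa>: "\<kappa> > 0"
  interpret P0: prob_space P0 by (rule P)
  have S: "prob_space (sample P0 m)" for m unfolding sample_def by (rule prob_space_PiM[OF P])
  have "integrable P0 (\<lambda>z. norm (\<phi>0 z))"
    by (rule P0.square_integrable_imp_integrable[OF _ \<phi>2]) simp
  then have \<phi>i: "integrable P0 \<phi>0" by (simp add: integrable_norm_iff)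
  obtain B where B: "B > 0" "\<And>n. n > 0 \<Longrightarrow> measure (PiM {..<n} (\<lambda>_. P0))
      {\<omega> \<in> space (PiM {..<n} (\<lambda>_. P0)). norm (scaled_sum \<phi>0 n \<omega>) > B} < \<kappa> / 2"
    using scaled_sum_tight[OF P \<phi> \<phi>2 \<phi>m, of "\<kappa> / 2"] \<kappa> by auto
  \<comment> \<open>The perturbation bound divided by \<eta>, for a sum of norm at most B and for an
    error vector and an operator error of norm at most \<eta> <= 1.\<close>
  define D where "D = (B + 1)\<^sup>2 + norm Omega0 * (2 * B + 1)"
  have D: "D > 0" unfolding D_def using B by (intro add_pos_nonneg) auto
  define \<eta> where "\<eta> = min 1 (e / D)"
  have "\<eta> * D \<le> (e / D) * D" unfolding \<eta>_def by (rule mult_right_mono) (use D in auto)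
  then have \<eta>: "\<eta> > 0" "\<eta> \<le> 1" "\<eta> * D \<le> e" using D e by (auto simp: \<eta>_def)
  \<comment> \<open>Four terms enter with the averaging factor 1/2, so thresholds \<eta> / 2 keep
    the error vector within \<eta>.\<close>
  let ?bad = "\<lambda>m. {\<omega>. sqrt (real (2*m)) * norm (remainder_term \<nu> P0 Phat phi 1 m \<omega>) > \<eta> / 2}
    \<union> {\<omega>. sqrt (real (2*m)) * norm (remainder_term \<nu> P0 Phat phi 2 m \<omega>) > \<eta> / 2}
    \<union> {\<omega>. sqrt (real (2*m)) * norm (drift_term P0 \<phi>0 phi 1 m \<omega>) > \<eta> / 2}
    \<union> {\<omega>. sqrt (real (2*m)) * norm (drift_term P0 \<phi>0 phi 2 m \<omega>) > \<eta> / 2}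
    \<union> {\<omega>. 1 * norm (Omega m \<omega> - Omega0) > \<eta>}"
  have "negligible_seq (sample P0) ?bad"
    using \<eta>(1) by (intro negligible_seq_union[OF S] small_op_negligible_seq[OF S] rem drift cons) auto
  then have "\<forall>\<^sub>F m in sequentially. \<exists>C\<in>sets (sample P0 m). ?bad m \<inter> space (sample P0 m) \<subseteq> C \<and> measure (sample P0 m) C < \<kappa> / 2"
    using \<kappa> unfolding negligible_seq_def by (meson half_gt_zero)
  then show "\<forall>\<^sub>F m in sequentially. \<exists>C\<in>sets (sample P0 m).
      {\<omega>. \<bar>real (2*m) * wq (crossfit_est \<nu> Phat phi m \<omega> - \<nu> P0) (Omega m \<omega>) - wq (scaled_sum \<phi>0 (2*m) \<omega>) Omega0\<bar> > e}
        \<inter> space (sample P0 m) \<subseteq> C \<and> measure (sample P0 m) C < \<kappa>"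
    using eventually_gt_at_top[of 0]
  proof eventually_elim
    case (elim m)
    interpret prob_space "sample P0 m" by (rule S)
    obtain C where C: "C \<in> sets (sample P0 m)" "?bad m \<inter> space (sample P0 m) \<subseteq> C" "measure (sample P0 m) C < \<kappa> / 2"
      using elim(1) by blast
    let ?S = "scaled_sum \<phi>0 (2*m)"
    have Sm[measurable]: "?S \<in> borel_measurable (sample P0 m)"
      unfolding sample_def by (rule borel_measurable_scaled_sum[OF \<phi>])
    let ?L = "{\<omega> \<in> space (sample P0 m). norm (?S \<omega>) > B}"
    have L: "?L \<in> sets (sample P0 m)" by measurable
    have "measure (sample P0 m) ?L < \<kappa> / 2" unfolding sample_def using B(2)[of "2*m"] elim(2) by simp
    then have CL: "measure (sample P0 m) (C \<union> ?L) < \<kappa>" using measure_Un_le[OF C(1) L] C(3) by linarith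
    have "\<bar>real (2*m) * wq (crossfit_est \<nu> Phat phi m \<omega> - \<nu> P0) (Omega m \<omega>) - wq (?S \<omega>) Omega0\<bar> \<le> e"
      if \<omega>: "\<omega> \<in> space (sample P0 m)" "\<omega> \<notin> C \<union> ?L" for \<omega>
    proof -
      let ?r = "sqrt (real (2*m))"
      let ?E = "(?r / 2) *\<^sub>R (\<Sum>j\<in>{1,2}. remainder_term \<nu> P0 Phat phi j m \<omega> + drift_term P0 \<phi>0 phi j m \<omega>)"
      have r: "?r > 0" "?r\<^sup>2 = real (2*m)" using elim(2) by auto
      have "?r *\<^sub>R (crossfit_est \<nu> Phat phi m \<omega> - \<nu> P0) = ?E + (?r / real (2*m)) *\<^sub>R (\<Sum>i<2*m. \<phi>0 (\<omega> i))"
        unfolding crossfit_est_expansion[OF \<phi>i \<phi>m elim(2)] by (simp add: scaleR_add_right)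
      also have "?r / real (2*m) = 1 / ?r" using r by (metis divide_divide_eq_left divide_self_if less_irrefl power2_eq_square)
      finally have ex: "?r *\<^sub>R (crossfit_est \<nu> Phat phi m \<omega> - \<nu> P0) = ?S \<omega> + ?E"
        by (simp add: scaled_sum_def)
      have good: "?r * norm (remainder_term \<nu> P0 Phat phi 1 m \<omega>) \<le> \<eta> / 2"
        "?r * norm (remainder_term \<nu> P0 Phat phi 2 m \<omega>) \<le> \<eta> / 2"
        "?r * norm (drift_term P0 \<phi>0 phi 1 m \<omega>) \<le> \<eta> / 2"
        "?r * norm (drift_term P0 \<phi>0 phi 2 m \<omega>) \<le> \<eta> / 2"
        "norm (Omega m \<omega> - Omega0) \<le> \<eta>"
        "norm (?S \<omega>) \<le> B"
        using \<omega> C(2) by (auto simp: subset_eq not_less)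
      have "norm ?E = (?r / 2) * norm ((remainder_term \<nu> P0 Phat phi 1 m \<omega> + drift_term P0 \<phi>0 phi 1 m \<omega>)
           + (remainder_term \<nu> P0 Phat phi 2 m \<omega> + drift_term P0 \<phi>0 phi 2 m \<omega>))"
        using r by simp
      also have "\<dots> \<le> (?r / 2) * ((norm (remainder_term \<nu> P0 Phat phi 1 m \<omega>) + norm (drift_term P0 \<phi>0 phi 1 m \<omega>))
           + (norm (remainder_term \<nu> P0 Phat phi 2 m \<omega>) + norm (drift_term P0 \<phi>0 phi 2 m \<omega>)))"
        using r by (intro mult_left_mono norm_triangle_le add_mono norm_triangle_ineq) auto
      also have "\<dots> = (?r * norm (remainder_term \<nu> P0 Phat phi 1 m \<omega>) + ?r * norm (drift_term P0 \<phi>0 phi 1 m \<omega>)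
           + ?r * norm (remainder_term \<nu> P0 Phat phi 2 m \<omega>) + ?r * norm (drift_term P0 \<phi>0 phi 2 m \<omega>)) / 2"
        by (simp add: algebra_simps)
      also have "\<dots> \<le> (\<eta> / 2 + \<eta> / 2 + \<eta> / 2 + \<eta> / 2) / 2"
        by (intro divide_right_mono add_mono good) simp
      also have "\<dots> = \<eta>" by simp
      finally have E: "norm ?E \<le> \<eta>" .
      have "\<bar>wq (?S \<omega> + ?E) (Omega m \<omega>) - wq (?S \<omega>) Omega0\<bar> \<le>
        norm (Omega m \<omega> - Omega0) * (norm (?S \<omega>) + norm ?E)\<^sup>2 + norm Omega0 * (norm ?E * (2 * norm (?S \<omega>) + norm ?E))"
        by (rule wq_perturb)
      also have "\<dots> \<le> \<eta> * (B + 1)\<^sup>2 + norm Omega0 * (\<eta> * (2 * B + 1))"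
        using good E \<eta> by (intro add_mono mult_mono power_mono) auto
      also have "\<dots> = \<eta> * D" by (simp add: D_def algebra_simps)
      also have "\<dots> \<le> e" by (rule \<eta>(3))
      finally have "\<bar>wq (?S \<omega> + ?E) (Omega m \<omega>) - wq (?S \<omega>) Omega0\<bar> \<le> e" .
      then show ?thesis unfolding ex[symmetric] wq_scaleR r(2) .
    qed
    then have "{\<omega>. \<bar>real (2*m) * wq (crossfit_est \<nu> Phat phi m \<omega> - \<nu> P0) (Omega m \<omega>) - wq (?S \<omega>) Omega0\<bar> > e}
        \<inter> space (sample P0 m) \<subseteq> C \<union> ?L"
      by (auto simp: not_le[symmetric] simp del: Un_iff)
    then show ?case using CL C(1) L by blast
  qed
qed

text \<open>The index is m with sample size n = 2 m. Measurability of the coverage event is a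
  hypothesis because none is assumed of the nuisance estimators. At m = 0 the quotient is 0 by
  convention, which limits do not see.\<close>

theorem theorem3:
  fixes lam :: "'z::polish_space measure"
    and M :: "'z measure set"
    and \<nu> :: "'z measure \<Rightarrow> 'h::{real_inner,banach,second_countable_topology}"
    and P0 :: "'z measure"
    and \<phi>0 :: "'z \<Rightarrow> 'h"
    and Phat :: "nat \<Rightarrow> nat \<Rightarrow> (nat \<Rightarrow> 'z) \<Rightarrow> 'z measure"
    and phi :: "nat \<Rightarrow> nat \<Rightarrow> (nat \<Rightarrow> 'z) \<Rightarrow> 'z \<Rightarrow> 'h"
    and Omega :: "nat \<Rightarrow> (nat \<Rightarrow> 'z) \<Rightarrow> ('h \<Rightarrow>\<^sub>L 'h)"
    and Omega0 :: "'h \<Rightarrow>\<^sub>L 'h"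
    and Q :: "'a measure" and G :: "'a \<Rightarrow> 'h"
    and \<alpha> \<zeta> :: real
    and zhat :: "nat \<Rightarrow> (nat \<Rightarrow> 'z) \<Rightarrow> real"
  assumes model: "dominated_model lam M" and P0M: "P0 \<in> M"
    and pd: "pathwise_differentiable lam M \<nu> P0"
    and eif: "is_EIF lam M \<nu> P0 \<phi>0" and phiL2: "\<phi>0 \<in> L2H P0"
    and est_model: "\<And>j m \<omega>. j \<in> {1,2} \<Longrightarrow> \<omega> \<in> space (sample P0 m) \<Longrightarrow> Phat j m \<omega> \<in> M"
    and est_eif: "\<And>j m \<omega>. j \<in> {1,2} \<Longrightarrow> \<omega> \<in> space (sample P0 m) \<Longrightarrow>
                     is_EIF lam M \<nu> (Phat j m \<omega>) (phi j m \<omega>)"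
    and est_dep: "\<And>j m \<omega> \<omega>'. j \<in> {1,2} \<Longrightarrow> (\<forall>i\<in>train_idx j m. \<omega> i = \<omega>' i) \<Longrightarrow>
                     Phat j m \<omega> = Phat j m \<omega>' \<and> phi j m \<omega> = phi j m \<omega>'"
    and rem: "\<And>j. j \<in> {1,2} \<Longrightarrow>
                small_op (sample P0) (\<lambda>m. sqrt (real (2*m))) (remainder_term \<nu> P0 Phat phi j)"
    and drift: "\<And>j. j \<in> {1,2} \<Longrightarrow>
                small_op (sample P0) (\<lambda>m. sqrt (real (2*m))) (drift_term P0 \<phi>0 phi j)"
    and phi_pos: "(\<integral>z. (norm (\<phi>0 z))\<^sup>2 \<partial>P0) > 0"
    and Omega_O: "\<And>m \<omega>. \<omega> \<in> space (sample P0 m) \<Longrightarrow> Omega m \<omega> \<in> op_class"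
    and Omega0_O: "Omega0 \<in> op_class"
    and Omega_cons: "small_op (sample P0) (\<lambda>m. 1) (\<lambda>m \<omega>. Omega m \<omega> - Omega0)"
    and alpha: "0 < \<alpha>" "\<alpha> < 1"
    and gauss: "tight_gaussian Q G P0 \<phi>0"
    and zeta: "\<zeta> = quantile_of Q (\<lambda>x. wq (G x) Omega0) (1 - \<alpha>)"
    and zhat_meas: "\<And>m. zhat m \<in> borel_measurable (sample P0 m)"
    and cover_meas: "\<And>m. {\<omega>\<in>space (sample P0 m).
                 wq (crossfit_est \<nu> Phat phi m \<omega> - \<nu> P0) (Omega m \<omega>) \<le> zhat m \<omega> / real (2*m)}
               \<in> sets (sample P0 m)"
  shows "((\<forall>e>0. (\<lambda>m. measure (sample P0 m) {\<omega>\<in>space (sample P0 m). \<bar>zhat m \<omega> - \<zeta>\<bar> > e}) \<longlonglongrightarrow> 0)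
           \<longrightarrow> (\<lambda>m. measure (sample P0 m) {\<omega>\<in>space (sample P0 m).
                 wq (crossfit_est \<nu> Phat phi m \<omega> - \<nu> P0) (Omega m \<omega>) \<le> zhat m \<omega> / real (2*m)})
               \<longlonglongrightarrow> 1 - \<alpha>)
       \<and> ((\<forall>\<delta>>0. (\<lambda>m. measure (sample P0 m) {\<omega>\<in>space (sample P0 m). zhat m \<omega> \<ge> \<zeta> - \<delta>}) \<longlonglongrightarrow> 1)
           \<longrightarrow> liminf (\<lambda>m. ereal (measure (sample P0 m) {\<omega>\<in>space (sample P0 m).
                 wq (crossfit_est \<nu> Phat phi m \<omega> - \<nu> P0) (Omega m \<omega>) \<le> zhat m \<omega> / real (2*m)}))
               \<ge> ereal (1 - \<alpha>))"
proof -
  have P: "prob_space P0" and sP[measurable_cong]: "sets P0 = sets borel"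
    using model P0M by (auto simp: dominated_model_def)
  interpret P0: prob_space P0 by (rule P)
  have \<phi>[measurable]: "\<phi>0 \<in> borel_measurable P0" and \<phi>2: "integrable P0 (\<lambda>z. (norm (\<phi>0 z))\<^sup>2)"
    using phiL2 by (auto simp: L2H_def)
  have "integrable P0 (\<lambda>z. norm (\<phi>0 z))"
    by (rule P0.square_integrable_imp_integrable[OF _ \<phi>2]) simp
  then have \<phi>i: "integrable P0 \<phi>0" by (simp add: integrable_norm_iff)
  have \<phi>m: "(\<integral>z. \<phi>0 z \<partial>P0) = 0" by (rule EIF_mean_zero[OF model P0M eif \<phi>i])
  have Q: "prob_space Q" and G[measurable]: "G \<in> borel_measurable Q"
    using gauss by (auto simp: tight_gaussian_def)
  have S: "prob_space (sample P0 m)" for m unfolding sample_def by (rule prob_space_PiM[OF P])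
  have wm[measurable]: "(\<lambda>x. wq x Omega0) \<in> borel_measurable borel"
    unfolding wq_def by (intro borel_measurable_continuous_onI continuous_intros)
  have wn: "wq x Omega0 \<ge> 0" for x
    using psd_op_nonneg[OF psd_op_op_class[OF Omega0_O]] by (simp add: wq_def)
  obtain a where sums: "\<And>x. (\<lambda>k. (inner (a k) x)\<^sup>2) sums wq x Omega0"
    using wq_sums[OF Omega0_O] by blast
  have w\<phi>: "integrable P0 (\<lambda>z. wq (\<phi>0 z) Omega0)"
  proof (rule Bochner_Integration.integrable_bound)
    show "integrable P0 (\<lambda>z. norm Omega0 * (norm (\<phi>0 z))\<^sup>2)" using \<phi>2 by simp
    have "\<bar>wq x Omega0\<bar> \<le> norm Omega0 * (norm x)\<^sup>2" for x
      using wq_perturb[of x 0 Omega0 0] by (simp add: wq_def)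
    then show "AE z in P0. norm (wq (\<phi>0 z) Omega0) \<le> norm (norm Omega0 * (norm (\<phi>0 z))\<^sup>2)" by simp
  qed measurable
  define W where "W m \<omega> = wq (scaled_sum \<phi>0 (2*m) \<omega>) Omega0" for m \<omega>
  define F where "F c = measure Q {x \<in> space Q. wq (G x) Omega0 \<le> c}" for c
  have Sm[measurable]: "scaled_sum \<phi>0 (2*m) \<in> borel_measurable (sample P0 m)" for m
    unfolding sample_def by (rule borel_measurable_scaled_sum[OF \<phi>])
  have Wm: "W m \<in> borel_measurable (sample P0 m)" for m unfolding W_def[abs_def] by measurable
  have atom: "measure Q {x \<in> space Q. wq (G x) Omega0 = c} = 0" for c
    by (rule tight_gaussian_quad_no_atom[OF phiL2 Omega0_O phi_pos gauss])
  have conv: "(\<lambda>m. measure (sample P0 m) {\<omega> \<in> space (sample P0 m). W m \<omega> \<le> c}) \<longlonglongrightarrow> F c" for c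
    unfolding F_def
  proof (rule Laplace_imp_cdf_tendsto[OF S Wm _ Q _ wn _ atom])
    show "W m \<omega> \<ge> 0" for m \<omega> by (simp add: W_def wn)
    show "(\<lambda>m. \<integral>\<omega>. exp (- (real t * W m \<omega>)) \<partial>sample P0 m) \<longlonglongrightarrow> (\<integral>x. exp (- (real t * wq (G x) Omega0)) \<partial>Q)" for t :: nat
    proof -
      have lim: "(\<lambda>n. \<integral>\<omega>. exp (- (real t * wq (scaled_sum \<phi>0 n \<omega>) Omega0)) \<partial>PiM {..<n} (\<lambda>_. P0))
          \<longlonglongrightarrow> (\<integral>x. exp (- (real t * wq (G x) Omega0)) \<partial>Q)"
        by (rule clt_quad_Laplace[OF P \<phi> \<phi>2 \<phi>m sums w\<phi> Q G tight_gaussian_char[OF gauss]]) simp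
      \<comment> \<open>The limit holds along all sample sizes and is restricted here to the even
        ones.\<close>
      have "filterlim (\<lambda>m::nat. 2 * m) sequentially sequentially"
        by (rule filterlim_subseq) (simp add: strict_mono_def)
      from filterlim_compose[OF lim this] show ?thesis by (simp add: W_def sample_def)
    qed
  qed measurable
  have p: "0 < 1 - \<alpha>" "1 - \<alpha> < 1" using alpha by auto
  have cont: "isCont F \<zeta>"
    using quantile_of_atomless(1)[OF Q _ atom p, of \<zeta>] by (simp add: F_def[abs_def])
  have F\<zeta>: "F \<zeta> = 1 - \<alpha>"
    using quantile_of_atomless(2)[OF Q _ atom p] by (simp add: F_def zeta)
  \<comment> \<open>An exact difference, so that for m > 0 coverage is literally the inequality W +
    R <= \<open>zhat\<close>; no measurability of R is needed.\<close>
  define R where "R m \<omega> = real (2*m) * wq (crossfit_est \<nu> Phat phi m \<omega> - \<nu> P0) (Omega m \<omega>) - W m \<omega>" for m \<omega>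
  have neg: "negligible_seq (sample P0) (\<lambda>m. {\<omega>. \<bar>R m \<omega>\<bar> > e})" if "e > 0" for e
    unfolding R_def W_def
    by (rule crossfit_quad_expansion_negligible[OF P \<phi> \<phi>2 \<phi>m rem drift Omega_cons that])
  define C where "C m = {\<omega>\<in>space (sample P0 m).
      wq (crossfit_est \<nu> Phat phi m \<omega> - \<nu> P0) (Omega m \<omega>) \<le> zhat m \<omega> / real (2*m)}" for m
  have Cm: "C m \<in> sets (sample P0 m)" for m unfolding C_def by (rule cover_meas)
  have rep: "\<omega> \<in> C m \<longleftrightarrow> W m \<omega> + R m \<omega> \<le> zhat m \<omega>" if "m > 0" "\<omega> \<in> space (sample P0 m)" for m \<omega>
    using that by (simp add: C_def R_def pos_le_divide_eq mult.commute)
  have rep1: "\<forall>\<^sub>F m in sequentially. \<forall>\<omega>\<in>space (sample P0 m). W m \<omega> + R m \<omega> \<le> zhat m \<omega> \<longrightarrow> \<omega> \<in> C m"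
    using eventually_gt_at_top[of 0] by eventually_elim (simp add: rep)
  have rep2: "\<forall>\<^sub>F m in sequentially. \<forall>\<omega>\<in>C m. W m \<omega> + R m \<omega> \<le> zhat m \<omega>"
    using eventually_gt_at_top[of 0]
  proof eventually_elim
    case (elim m)
    have "\<omega> \<in> space (sample P0 m)" if "\<omega> \<in> C m" for \<omega> using that by (simp add: C_def)
    then show ?case using rep[OF elim] by blast
  qed
  have lower: "\<forall>\<^sub>F m in sequentially. measure (sample P0 m) (C m) > 1 - \<alpha> - e"
    if "\<And>\<delta>. \<delta> > 0 \<Longrightarrow> (\<lambda>m. measure (sample P0 m) {\<omega>\<in>space (sample P0 m). zhat m \<omega> \<ge> \<zeta> - \<delta>}) \<longlonglongrightarrow> 1" "e > 0" for e
    using asymptotic_coverage_lower[OF S Wm zhat_meas Cm rep1 neg conv cont that] by (simp add: F\<zeta>)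
  have upper: "\<forall>\<^sub>F m in sequentially. measure (sample P0 m) (C m) < 1 - \<alpha> + e"
    if "\<And>\<delta>. \<delta> > 0 \<Longrightarrow> (\<lambda>m. measure (sample P0 m) {\<omega>\<in>space (sample P0 m). zhat m \<omega> \<le> \<zeta> + \<delta>}) \<longlonglongrightarrow> 1" "e > 0" for e
    using asymptotic_coverage_upper[OF S Wm zhat_meas Cm rep2 neg conv cont that] by (simp add: F\<zeta>)
  \<comment> \<open>Reduces convergence in probability to the two one-sided statements: any
    measurable event containing the one where the error is at most \<delta> has probability tending
    to 1.\<close>
  have one: "(\<lambda>m. measure (sample P0 m) (A m)) \<longlonglongrightarrow> 1"
    if h: "(\<lambda>m. measure (sample P0 m) {\<omega>\<in>space (sample P0 m). \<bar>zhat m \<omega> - \<zeta>\<bar> > \<delta>}) \<longlonglongrightarrow> 0"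
      and A: "\<And>m. A m \<in> sets (sample P0 m)"
      and sub: "\<And>m. {\<omega>\<in>space (sample P0 m). \<not> \<bar>zhat m \<omega> - \<zeta>\<bar> > \<delta>} \<subseteq> A m" for \<delta> A
  proof (rule tendsto_sandwich[of "\<lambda>m. 1 - measure (sample P0 m) {\<omega>\<in>space (sample P0 m). \<bar>zhat m \<omega> - \<zeta>\<bar> > \<delta>}" _ _ "\<lambda>_. 1"])
    note [measurable] = zhat_meas
    show "\<forall>\<^sub>F m in sequentially. 1 - measure (sample P0 m) {\<omega>\<in>space (sample P0 m). \<bar>zhat m \<omega> - \<zeta>\<bar> > \<delta>} \<le> measure (sample P0 m) (A m)"
    proof (rule always_eventually, rule allI)
      fix m
      interpret prob_space "sample P0 m" by (rule S)
      have "measure (sample P0 m) {\<omega>\<in>space (sample P0 m). \<not> \<bar>zhat m \<omega> - \<zeta>\<bar> > \<delta>} \<le> measure (sample P0 m) (A m)"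
        by (rule finite_measure_mono[OF sub A])
      then show "1 - measure (sample P0 m) {\<omega>\<in>space (sample P0 m). \<bar>zhat m \<omega> - \<zeta>\<bar> > \<delta>} \<le> measure (sample P0 m) (A m)"
        by (subst (asm) prob_neg) measurable
    qed
    show "\<forall>\<^sub>F m in sequentially. measure (sample P0 m) (A m) \<le> 1"
      using S by (simp add: prob_space.prob_le_1)
    show "(\<lambda>m. 1 - measure (sample P0 m) {\<omega>\<in>space (sample P0 m). \<bar>zhat m \<omega> - \<zeta>\<bar> > \<delta>}) \<longlonglongrightarrow> 1"
      using tendsto_diff[OF tendsto_const[of 1] h] by simp
  qed simp
  note [measurable] = zhat_meas
  show ?thesis
    unfolding C_def[symmetric]
  proof (intro conjI impI)
    assume h: "\<forall>e>0. (\<lambda>m. measure (sample P0 m) {\<omega>\<in>space (sample P0 m). \<bar>zhat m \<omega> - \<zeta>\<bar> > e}) \<longlonglongrightarrow> 0"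
    have l: "(\<lambda>m. measure (sample P0 m) {\<omega>\<in>space (sample P0 m). zhat m \<omega> \<ge> \<zeta> - \<delta>}) \<longlonglongrightarrow> 1" if "\<delta> > 0" for \<delta>
      by (rule one[OF h[rule_format, OF that]]) (measurable, auto)
    have u: "(\<lambda>m. measure (sample P0 m) {\<omega>\<in>space (sample P0 m). zhat m \<omega> \<le> \<zeta> + \<delta>}) \<longlonglongrightarrow> 1" if "\<delta> > 0" for \<delta>
      by (rule one[OF h[rule_format, OF that]]) (measurable, auto)
    show "(\<lambda>m. measure (sample P0 m) (C m)) \<longlonglongrightarrow> 1 - \<alpha>"
    proof (rule order_tendstoI)
      fix y assume "y < 1 - \<alpha>"
      then show "\<forall>\<^sub>F m in sequentially. y < measure (sample P0 m) (C m)"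
        using lower[OF l, of "1 - \<alpha> - y"] by simp
    next
      fix y assume "1 - \<alpha> < y"
      then show "\<forall>\<^sub>F m in sequentially. measure (sample P0 m) (C m) < y"
        using upper[OF u, of "y - (1 - \<alpha>)"] by simp
    qed
  next
    assume h: "\<forall>\<delta>>0. (\<lambda>m. measure (sample P0 m) {\<omega>\<in>space (sample P0 m). zhat m \<omega> \<ge> \<zeta> - \<delta>}) \<longlonglongrightarrow> 1"
    show "ereal (1 - \<alpha>) \<le> liminf (\<lambda>m. ereal (measure (sample P0 m) (C m)))"
    proof (rule ereal_le_epsilon2)
      fix e :: real assume "e > 0"
      then have "\<forall>\<^sub>F m in sequentially. ereal (1 - \<alpha> - e) \<le> ereal (measure (sample P0 m) (C m))"
        using lower[of e] h by (auto elim!: eventually_mono)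
      then have "ereal (1 - \<alpha> - e) \<le> liminf (\<lambda>m. ereal (measure (sample P0 m) (C m)))"
        by (rule Liminf_bounded)
      then have "ereal (1 - \<alpha> - e) + ereal e \<le> liminf (\<lambda>m. ereal (measure (sample P0 m) (C m))) + ereal e"
        by (rule add_right_mono)
      then show "ereal (1 - \<alpha>) \<le> liminf (\<lambda>m. ereal (measure (sample P0 m) (C m))) + ereal e"
        by simp
    qed
  qed
qed

end
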